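(* Let $U\subset\mathbb{S}$ be a patch. The restriction operator $$\mathcal A_U:\ \mathcal H_+(\mathbb{S})\times \mathcal H_-(\mathbb{S})\longrightarrow L^2(U)^3,\qquad \mathcal A_U(\mathbf f_+,\mathbf f_-)=(\mathbf f_+ + \mathbf f_-)|_U,$$ has a nontrivial null space, i.e., $\ker(\mathcal A_U)\neq\{(0,0)\}$.
   Context: $\mathbb{S}=\{x\in\mathbb R^3:|x|=1\}$ is the unit sphere, with outward unit normal $\eta(x)=x$ and surface gradient $\nabla_{\mathbb S}$. A patch $U$ is a non-empty open subregion of $\mathbb{S}$ with connected Lipschitz boundary such that $V=\mathbb{S}\setminus\overline U$ is non-empty. Let $\{Y_{n,k}\}_{n\ge 0,\,|k|\le n}$ be an orthonormal basis of $L^2(\mathbb{S})$ of scalar spherical harmonics ($Y_{n,k}$ of degree $n$) and set $$\mathbf G^{\mathrm{ext}}_{n,k}=\nabla_{\mathbb S}Y_{n,k}+n\,\eta Y_{n,k},\qquad \mathbf G^{\mathrm{int}}_{n,k}=\nabla_{\mathbb S}Y_{n,k}-(n+1)\,\eta Y_{n,k}.$$ The Hardy spaces are the closed subspaces of $L^2(\mathbb S)^3$ $$\mathcal H_+(\mathbb S)=\overline{\mathrm{span}\{\mathbf G^{\mathrm{ext}}_{n,k}:n\ge1,|k|\le n\}}^{L^2(\mathbb S)^3},\qquad \mathcal H_-(\mathbb S)=\overline{\mathrm{span}\{\mathbf G^{\mathrm{int}}_{n,k}:n\ge0,|k|\le n\}}^{L^2(\mathbb S)^3}.$$ Equivalently,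 $\mathcal H_+(\mathbb S)$ (resp. $\mathcal H_-(\mathbb S)$) consists of the nontangential boundary limits $\nabla u|_{\mathbb S}$ of gradients of functions $u$ harmonic in the open unit ball (resp. harmonic in the complement of the closed unit ball with $u(x)\to0$ as $|x|\to\infty$) such that the nontangential maximal function of $\nabla u$ on $\mathbb S$, taken from the respective side, is square-integrable. *)

theory Defs
  imports "HOL-Analysis.Analysis"
begin

section \<open>The unit sphere and its surface measure\<close>

abbreviation unit_sphere :: "(real^3) set" where
  "unit_sphere \<equiv> sphere 0 1"

text \<open>
  The surface measure is the cone measure: the area of \<open>A\<close> is three times the volume
  of the punctured cone \<open>{x. 0 < norm x < 1, x / norm x \<in> A}\<close> (here \<open>sgn x = x / norm x\<close>).
  Its total mass is \<open>4 * pi\<close>.  The underlying space of the measure is the sphere itself.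
\<close>

definition sphere_measure :: "(real^3) measure" where
  "sphere_measure = scale_measure 3
     (distr (restrict_space lborel (ball 0 1 - {0})) (restrict_space borel unit_sphere) sgn)"


section \<open>Square-integrable functions\<close>

text \<open>
  Elements of \<open>L\<^sup>2\<close> are represented by functions; the identification of functions that agree
  almost everywhere is made explicit where it matters.
\<close>

definition L2 :: "'a measure \<Rightarrow> ('a \<Rightarrow> 'b::euclidean_space) set" where
  "L2 M = {f \<in> borel_measurable M. integrable M (\<lambda>x. (norm (f x))\<^sup>2)}"

definition L2_norm :: "'a measure \<Rightarrow> ('a \<Rightarrow> 'b::euclidean_space) \<Rightarrow> real" where
  "L2_norm M f = sqrt (\<integral>x. (norm (f x))\<^sup>2 \<partial>M)"

definition L2_inner :: "'a measure \<Rightarrow> ('a \<Rightarrow> 'b::euclidean_space) \<Rightarrow> ('a \<Rightarrow> 'b) \<Rightarrow> real" where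
  "L2_inner M f g = (\<integral>x. f x \<bullet> g x \<partial>M)"

definition L2_closure ::
    "'a measure \<Rightarrow> ('a \<Rightarrow> 'b::euclidean_space) set \<Rightarrow> ('a \<Rightarrow> 'b) set" where
  "L2_closure M F =
     {f \<in> L2 M. \<forall>e>0. \<exists>g\<in>F \<inter> L2 M. L2_norm M (\<lambda>x. f x - g x) < e}"

text \<open>Function types are not an instance of \<^class>\<open>real_vector\<close>, so the span is written out.\<close>

definition fun_span :: "('a \<Rightarrow> 'b::real_vector) set \<Rightarrow> ('a \<Rightarrow> 'b) set" where
  "fun_span B = {(\<lambda>x. \<Sum>b\<in>T. c b *\<^sub>R b x) | T c. finite T \<and> T \<subseteq> B}"


section \<open>Spherical harmonics\<close>

definition laplacian :: "('a::euclidean_space \<Rightarrow> real) \<Rightarrow> 'a \<Rightarrow> real" where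
  "laplacian f x = (\<Sum>b\<in>Basis. (deriv ^^ 2) (\<lambda>t. f (x + t *\<^sub>R b)) 0)"

definition spherical_harmonic :: "nat \<Rightarrow> (real^3 \<Rightarrow> real) \<Rightarrow> bool" where
  "spherical_harmonic n Y \<longleftrightarrow>
     (\<exists>p. real_polynomial_function p \<and>
          (\<forall>t x. p (t *\<^sub>R x) = t ^ n * p x) \<and>
          (\<forall>x. laplacian p x = 0) \<and>
          (\<forall>x\<in>unit_sphere. Y x = p x))"

definition spherical_harmonic_basis :: "(nat \<Rightarrow> int \<Rightarrow> real^3 \<Rightarrow> real) \<Rightarrow> bool" where
  "spherical_harmonic_basis Y \<longleftrightarrow>
     (\<forall>n k. \<bar>k\<bar> \<le> int n \<longrightarrow> spherical_harmonic n (Y n k)) \<and>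
     (\<forall>n k m l. \<bar>k\<bar> \<le> int n \<longrightarrow> \<bar>l\<bar> \<le> int m \<longrightarrow>
        L2_inner sphere_measure (Y n k) (Y m l) = (if n = m \<and> k = l then 1 else 0)) \<and>
     L2_closure sphere_measure (fun_span {Y n k | n k. \<bar>k\<bar> \<le> int n}) = L2 sphere_measure"


section \<open>Hardy spaces\<close>

text \<open>
  The surface gradient at a point of the sphere is the Euclidean gradient of the extension
  that is constant along rays, so it depends only on the values of \<open>Y\<close> on the sphere and is
  tangential.
\<close>

definition surface_grad :: "(real^3 \<Rightarrow> real) \<Rightarrow> real^3 \<Rightarrow> real^3" where
  "surface_grad Y x = (THE v. GDERIV (\<lambda>y. Y (sgn y)) x :> v)"

text \<open>On the unit sphere, the outward unit normal at \<open>x\<close> is \<open>x\<close> itself.\<close>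

definition G_ext :: "(nat \<Rightarrow> int \<Rightarrow> real^3 \<Rightarrow> real) \<Rightarrow> nat \<Rightarrow> int \<Rightarrow> real^3 \<Rightarrow> real^3" where
  "G_ext Y n k x = surface_grad (Y n k) x + (real n * Y n k x) *\<^sub>R x"

definition G_int :: "(nat \<Rightarrow> int \<Rightarrow> real^3 \<Rightarrow> real) \<Rightarrow> nat \<Rightarrow> int \<Rightarrow> real^3 \<Rightarrow> real^3" where
  "G_int Y n k x = surface_grad (Y n k) x - (real (n + 1) * Y n k x) *\<^sub>R x"

definition hardy_plus :: "(nat \<Rightarrow> int \<Rightarrow> real^3 \<Rightarrow> real) \<Rightarrow> (real^3 \<Rightarrow> real^3) set" where
  "hardy_plus Y =
     L2_closure sphere_measure (fun_span {G_ext Y n k | n k. n \<ge> 1 \<and> \<bar>k\<bar> \<le> int n})"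

definition hardy_minus :: "(nat \<Rightarrow> int \<Rightarrow> real^3 \<Rightarrow> real) \<Rightarrow> (real^3 \<Rightarrow> real^3) set" where
  "hardy_minus Y =
     L2_closure sphere_measure (fun_span {G_int Y n k | n k. \<bar>k\<bar> \<le> int n})"


section \<open>Patches\<close>

text \<open>
  Near each boundary point \<open>p\<close> the set is, in the coordinates \<open>(x \<bullet> a, x \<bullet> b)\<close> obtained by
  orthogonal projection onto the tangent plane at \<open>p\<close> (a smooth chart of the sphere around
  \<open>p\<close>), one side of the graph of a Lipschitz function.
\<close>

definition lipschitz_boundary :: "(real^3) set \<Rightarrow> bool" where
  "lipschitz_boundary U \<longleftrightarrow>
     (\<forall>p \<in> (top_of_set unit_sphere) frontier_of U.
        \<exists>a b r L (\<phi>::real \<Rightarrow> real).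
          norm a = 1 \<and> norm b = 1 \<and> a \<bullet> b = 0 \<and> a \<bullet> p = 0 \<and> b \<bullet> p = 0 \<and>
          r > 0 \<and> L-lipschitz_on UNIV \<phi> \<and>
          (\<forall>x \<in> unit_sphere \<inter> ball p r. x \<in> U \<longleftrightarrow> x \<bullet> b < \<phi> (x \<bullet> a)))"

definition patch :: "(real^3) set \<Rightarrow> bool" where
  "patch U \<longleftrightarrow>
     U \<noteq> {} \<and> openin (top_of_set unit_sphere) U \<and> connected U \<and>
     connected ((top_of_set unit_sphere) frontier_of U) \<and> lipschitz_boundary U \<and>
     unit_sphere - closure U \<noteq> {}"


section \<open>The restriction operator\<close>

definition restriction_op ::
    "(real^3) set \<Rightarrow> (real^3 \<Rightarrow> real^3) \<times> (real^3 \<Rightarrow> real^3) \<Rightarrow> (real^3 \<Rightarrow> real^3)" where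
  "restriction_op U = (\<lambda>(f, g). restrict (\<lambda>x. f x + g x) U)"

text \<open>
  \<open>L\<^sup>2(U)\<close> is \<^const>\<open>L2\<close> of the surface measure restricted to \<open>U\<close>; its zero element is
  represented by the functions that vanish almost everywhere on \<open>U\<close>.
\<close>

definition restriction_kernel ::
    "(nat \<Rightarrow> int \<Rightarrow> real^3 \<Rightarrow> real) \<Rightarrow> (real^3) set
      \<Rightarrow> ((real^3 \<Rightarrow> real^3) \<times> (real^3 \<Rightarrow> real^3)) set" where
  "restriction_kernel Y U =
     {fg \<in> hardy_plus Y \<times> hardy_minus Y.
        AE x in restrict_space sphere_measure U. restriction_op U fg x = 0}"

end

theory Submission
  imports Defs
begin

text \<open>
  Every square-integrable normal field \<open>h \<eta>\<close> lies in the sum of the two Hardy spaces: since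
  \<open>\<eta> Y\<^bsub>n,k\<^esub> = (G_ext - G_int) / (2 n + 1)\<close>, it suffices that the map
  \<open>Y\<^bsub>n,k\<^esub> \<mapsto> G_ext / (2 n + 1)\<close> extends to a bounded operator on \<open>L\<^sup>2\<close>.  The fields \<open>G_ext\<close> are the
  gradients of the solid harmonics, which are orthogonal with squared norm \<open>n (2 n + 1)\<close>, so the
  map is a contraction.  Taking for \<open>h\<close> the indicator function of the complement of the closure
  of \<open>U\<close> gives a non-zero element of the kernel.

  Orthogonality of the gradients comes from the rotation invariance of the surface measure: the
  angular derivatives \<open>L\<^sub>a\<^sub>b = x\<^sub>a \<partial>\<^sub>b - x\<^sub>b \<partial>\<^sub>a\<close> integrate to zero, and
  summing \<open>L\<^sub>a\<^sub>b (p L\<^sub>a\<^sub>b q)\<close> over all \<open>a, b\<close> is Green's identity for \<open>p\<close> and \<open>q\<close>.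
\<close>

section \<open>Directional derivatives of polynomial functions\<close>

text \<open>The derivative is a total function of the point, so \<open>dir_deriv v p\<close> can
  itself be differentiated; for a polynomial \<open>p\<close> it is again a polynomial.\<close>

definition dir_deriv :: "'a::real_normed_vector \<Rightarrow> ('a \<Rightarrow> real) \<Rightarrow> 'a \<Rightarrow> real" where
  "dir_deriv v f x = frechet_derivative f (at x) v"

definition grad :: "('a::euclidean_space \<Rightarrow> real) \<Rightarrow> 'a \<Rightarrow> 'a" where
  "grad f x = (\<Sum>b\<in>Basis. dir_deriv b f x *\<^sub>R b)"

lemma real_polynomial_function_inner_left [intro]: "real_polynomial_function (\<lambda>x. x \<bullet> b)"
  by (intro real_polynomial_function.intros(1) bounded_linear_inner_left)

lemmas polynomial_function_intros =
  real_polynomial_function.intros(2-4) real_polynomial_function_diff real_polynomial_function_sum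
  real_polynomial_function_inner_left

lemma dir_deriv_eq: "(f has_derivative D) (at x) \<Longrightarrow> dir_deriv v f x = D v"
  by (simp add: dir_deriv_def frechet_derivative_at[symmetric])

text \<open>Both claims are carried through one induction, because the product rule builds the
  derivative from the values and derivatives of the factors. Uniqueness of the Frechet derivative
  later identifies the witness \<open>D v\<close> with \<open>dir_deriv v p\<close>.\<close>

lemma polynomial_dir_deriv_exists:
  "real_polynomial_function p \<Longrightarrow>
    \<exists>D. \<forall>v. real_polynomial_function (D v) \<and> (\<forall>x. (p has_derivative (\<lambda>v. D v x)) (at x))"
proof (induction rule: real_polynomial_function.induct)
  case (linear f)
  then show ?case
    by (intro exI[of _ "\<lambda>v x. f v"]) (simp add: bounded_linear_imp_has_derivative real_polynomial_function.intros(2))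
next
  case (const c)
  then show ?case by (intro exI[of _ "\<lambda>v x. 0"]) (simp add: real_polynomial_function.intros(2))
next
  case (add f g)
  then obtain D E where "\<forall>v. real_polynomial_function (D v) \<and> (\<forall>x. (f has_derivative (\<lambda>v. D v x)) (at x))"
    "\<forall>v. real_polynomial_function (E v) \<and> (\<forall>x. (g has_derivative (\<lambda>v. E v x)) (at x))"
    by blast
  then show ?case
    by (intro exI[of _ "\<lambda>v x. D v x + E v x"]) (simp add: has_derivative_add real_polynomial_function.intros(3))
next
  case (mult f g)
  then obtain D E where D: "\<forall>v. real_polynomial_function (D v) \<and> (\<forall>x. (f has_derivative (\<lambda>v. D v x)) (at x))"
    and E: "\<forall>v. real_polynomial_function (E v) \<and> (\<forall>x. (g has_derivative (\<lambda>v. E v x)) (at x))"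
    by blast
  then have "(\<forall>x. ((\<lambda>a. f a * g a) has_derivative (\<lambda>v. f x * E v x + D v x * g x)) (at x))"
    using has_derivative_mult by blast
  with mult.hyps D E show ?case
    by (intro exI[of _ "\<lambda>v x. f x * E v x + D v x * g x"]) (simp add: polynomial_function_intros)
qed

lemma polynomial_has_derivative:
  assumes "real_polynomial_function p"
  shows "(p has_derivative (\<lambda>v. dir_deriv v p x)) (at x)"
  using polynomial_dir_deriv_exists[OF assms] by (metis dir_deriv_eq ext has_derivative_eq_rhs)

lemma real_polynomial_function_dir_deriv [intro]:
  assumes "real_polynomial_function p"
  shows "real_polynomial_function (dir_deriv v p)"
proof -
  obtain D where D: "\<forall>v. real_polynomial_function (D v) \<and> (\<forall>x. (p has_derivative (\<lambda>v. D v x)) (at x))"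
    using polynomial_dir_deriv_exists[OF assms] by blast
  then have "dir_deriv v p = D v"
    by (metis dir_deriv_eq ext)
  with D show ?thesis by simp
qed

lemma continuous_on_real_polynomial_function:
  fixes p :: "'a::euclidean_space \<Rightarrow> real"
  assumes "real_polynomial_function p" shows "continuous_on S p"
  by (meson polynomial_has_derivative[OF assms] continuous_at_imp_continuous_on has_derivative_continuous)

lemma linear_dir_deriv:
  assumes "real_polynomial_function p"
  shows "linear (\<lambda>v. dir_deriv v p x)"
  using polynomial_has_derivative[OF assms] has_derivative_linear by blast

lemma dir_deriv_expand:
  fixes p :: "'a::euclidean_space \<Rightarrow> real"
  assumes "real_polynomial_function p"
  shows "dir_deriv v p x = (\<Sum>b\<in>Basis. (v \<bullet> b) * dir_deriv b p x)"
proof -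
  interpret linear "\<lambda>v. dir_deriv v p x" by (rule linear_dir_deriv[OF assms])
  have "dir_deriv v p x = dir_deriv (\<Sum>b\<in>Basis. (v \<bullet> b) *\<^sub>R b) p x"
    by (simp add: euclidean_representation)
  also have "\<dots> = (\<Sum>b\<in>Basis. (v \<bullet> b) * dir_deriv b p x)"
    by (simp add: sum scaleR)
  finally show ?thesis .
qed

lemma dir_deriv_inner_grad:
  fixes p :: "'a::euclidean_space \<Rightarrow> real"
  assumes "real_polynomial_function p"
  shows "dir_deriv v p x = v \<bullet> grad p x"
  by (simp add: dir_deriv_expand[OF assms, of v] grad_def inner_sum_right mult.commute)

lemma inner_grad_grad: "grad p x \<bullet> grad q x = (\<Sum>b\<in>Basis. dir_deriv b p x * dir_deriv b q x)"
  by (subst euclidean_inner) (simp add: grad_def)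

lemma dir_deriv_mult:
  assumes "real_polynomial_function p" "real_polynomial_function q"
  shows "dir_deriv v (\<lambda>x. p x * q x) x = p x * dir_deriv v q x + dir_deriv v p x * q x"
  by (rule dir_deriv_eq[OF has_derivative_mult[OF assms[THEN polynomial_has_derivative]]])

lemma dir_deriv_diff:
  assumes "real_polynomial_function p" "real_polynomial_function q"
  shows "dir_deriv v (\<lambda>x. p x - q x) x = dir_deriv v p x - dir_deriv v q x"
  by (rule dir_deriv_eq[OF has_derivative_diff[OF assms[THEN polynomial_has_derivative]]])

lemma dir_deriv_sum:
  assumes "\<And>i. i \<in> I \<Longrightarrow> real_polynomial_function (p i)"
  shows "dir_deriv v (\<lambda>x. \<Sum>i\<in>I. p i x) x = (\<Sum>i\<in>I. dir_deriv v (p i) x)"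
  by (rule dir_deriv_eq[OF has_derivative_sum]) (simp add: assms polynomial_has_derivative)

lemma dir_deriv_inner_left: "dir_deriv v (\<lambda>x. x \<bullet> b) x = v \<bullet> b"
  by (rule dir_deriv_eq[OF bounded_linear_imp_has_derivative[OF bounded_linear_inner_left]])

lemma DERIV_dir_deriv:
  assumes "real_polynomial_function p"
  shows "((\<lambda>t. p (x + t *\<^sub>R v)) has_real_derivative dir_deriv v p (x + t *\<^sub>R v)) (at t)"
proof -
  have l: "((\<lambda>t. x + t *\<^sub>R v) has_derivative (\<lambda>h. h *\<^sub>R v)) (at t)"
    by (auto intro!: derivative_eq_intros)
  have "((\<lambda>t. p (x + t *\<^sub>R v)) has_derivative (\<lambda>h. dir_deriv (h *\<^sub>R v) p (x + t *\<^sub>R v))) (at t)"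
    by (rule has_derivative_compose[OF l polynomial_has_derivative[OF assms]])
  moreover have "dir_deriv (h *\<^sub>R v) p y = dir_deriv v p y * h" for h y
    using linear_scale[OF linear_dir_deriv[OF assms]] by auto
  ultimately show ?thesis
    by (simp add: has_field_derivative_def)
qed

lemma laplacian_polynomial:
  fixes p :: "'a::euclidean_space \<Rightarrow> real"
  assumes "real_polynomial_function p"
  shows "laplacian p x = (\<Sum>b\<in>Basis. dir_deriv b (dir_deriv b p) x)"
proof -
  have "deriv (\<lambda>t. p (x + t *\<^sub>R b)) = (\<lambda>t. dir_deriv b p (x + t *\<^sub>R b))" for b
    by (rule ext) (rule DERIV_imp_deriv[OF DERIV_dir_deriv[OF assms]])
  moreover have "deriv (\<lambda>t. dir_deriv b p (x + t *\<^sub>R b)) 0 = dir_deriv b (dir_deriv b p) (x + 0 *\<^sub>R b)" for b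
    by (rule DERIV_imp_deriv[OF DERIV_dir_deriv[OF real_polynomial_function_dir_deriv[OF assms]]])
  ultimately show ?thesis
    by (simp add: laplacian_def numeral_2_eq_2)
qed

section \<open>Euler's identities for homogeneous polynomials\<close>

lemma euler_homogeneous:
  fixes p :: "'a::euclidean_space \<Rightarrow> real"
  assumes p: "real_polynomial_function p" and hom: "\<And>t x. p (t *\<^sub>R x) = t ^ n * p x"
  shows "(\<Sum>a\<in>Basis. (x \<bullet> a) * dir_deriv a p x) = real n * p x"
proof -
  \<comment> \<open>The line through \<open>0\<close> in direction \<open>x\<close> is the ray on
    which homogeneity gives \<open>t ^ n * p x\<close>; both forms are differentiated at
    \<open>t = 1\<close>.\<close>
  have "((\<lambda>t. p (0 + t *\<^sub>R x)) has_real_derivative dir_deriv x p (0 + 1 *\<^sub>R x)) (at 1)"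
    by (rule DERIV_dir_deriv[OF p])
  then have "((\<lambda>t. t ^ n * p x) has_real_derivative dir_deriv x p x) (at 1)"
    by (simp add: hom)
  moreover have "((\<lambda>t. t ^ n * p x) has_real_derivative real n * p x) (at 1)"
    by (auto intro!: derivative_eq_intros)
  ultimately have "dir_deriv x p x = real n * p x"
    using DERIV_unique by blast
  then show ?thesis
    using dir_deriv_expand[OF p, of x x] by simp
qed

lemma euler_homogeneous2:
  fixes p :: "'a::euclidean_space \<Rightarrow> real"
  assumes p: "real_polynomial_function p" and hom: "\<And>t x. p (t *\<^sub>R x) = t ^ n * p x"
  shows "(\<Sum>a\<in>Basis. \<Sum>b\<in>Basis. (x \<bullet> a) * (x \<bullet> b) * dir_deriv b (dir_deriv a p) x)
           = real n * (real n - 1) * p x"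
proof -
  have pa: "real_polynomial_function (dir_deriv a p)" for a
    using p by blast
  have "(\<lambda>x. \<Sum>a\<in>Basis. (x \<bullet> a) * dir_deriv a p x) = (\<lambda>x. real n * p x)"
    using euler_homogeneous[OF assms] by blast
  \<comment> \<open>Euler's identity is differentiated along a fixed \<open>v\<close>, and only
    afterwards is \<open>v\<close> set equal to the base point \<open>x\<close>. The extra term is
    then the first Euler sum, which turns \<open>n * n\<close> into
    \<open>n * (n - 1)\<close>.\<close>
  then have "dir_deriv v (\<lambda>x. \<Sum>a\<in>Basis. (x \<bullet> a) * dir_deriv a p x) x = dir_deriv v (\<lambda>x. real n * p x) x" for v
    by simp
  then have *: "(\<Sum>a\<in>Basis. (x \<bullet> a) * dir_deriv v (dir_deriv a p) x + (v \<bullet> a) * dir_deriv a p x)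
      = real n * dir_deriv v p x" for v
    by (subst (asm) dir_deriv_sum)
      (auto simp: dir_deriv_mult p pa real_polynomial_function_inner_left dir_deriv_inner_left
        real_polynomial_function.intros(2) dir_deriv_eq[OF has_derivative_const])
  have "(\<Sum>a\<in>Basis. (x \<bullet> a) * dir_deriv x (dir_deriv a p) x) + real n * p x = real n * (real n * p x)"
    using *[of x] euler_homogeneous[OF assms, of x] dir_deriv_expand[OF p, of x x]
    by (simp add: sum.distrib)
  then show ?thesis
    by (subst (asm) dir_deriv_expand[OF pa]) (simp add: sum_distrib_left mult.assoc algebra_simps)
qed

section \<open>Angular derivatives\<close>

text \<open>For orthonormal \<open>a\<close> and \<open>b\<close> this is the infinitesimal
  generator of the rotations that turn \<open>a\<close> towards \<open>b\<close>. It differentiates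
  along a field tangent to all spheres centred at the origin.\<close>

definition rot_deriv :: "'a::euclidean_space \<Rightarrow> 'a \<Rightarrow> ('a \<Rightarrow> real) \<Rightarrow> 'a \<Rightarrow> real" where
  "rot_deriv a b f x = (x \<bullet> a) * dir_deriv b f x - (x \<bullet> b) * dir_deriv a f x"

lemma real_polynomial_function_rot_deriv [intro]:
  "real_polynomial_function p \<Longrightarrow> real_polynomial_function (rot_deriv a b p)"
  unfolding rot_deriv_def[abs_def]
  by (intro polynomial_function_intros real_polynomial_function_dir_deriv)

lemma rot_deriv_mult:
  assumes "real_polynomial_function p" "real_polynomial_function q"
  shows "rot_deriv a b (\<lambda>x. p x * q x) x = p x * rot_deriv a b q x + rot_deriv a b p x * q x"
  by (simp add: rot_deriv_def dir_deriv_mult[OF assms] algebra_simps)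

text \<open>This is Lagrange's identity for the vectors \<open>x\<close>, \<open>grad p x\<close>
  and \<open>grad q x\<close>; Euler's identity evaluates the two radial products. The factor 2
  arises because each coordinate plane is counted in both orders.\<close>

lemma sum_rot_deriv_mult_rot_deriv:
  fixes p q :: "'a::euclidean_space \<Rightarrow> real"
  assumes p: "real_polynomial_function p" and hp: "\<And>t x. p (t *\<^sub>R x) = t ^ n * p x"
    and q: "real_polynomial_function q" and hq: "\<And>t x. q (t *\<^sub>R x) = t ^ m * q x"
  shows "(\<Sum>a\<in>Basis. \<Sum>b\<in>Basis. rot_deriv a b p x * rot_deriv a b q x)
           = 2 * ((x \<bullet> x) * (grad p x \<bullet> grad q x) - real n * real m * p x * q x)"
proof -
  let ?P = "\<lambda>a. dir_deriv a p x" and ?Q = "\<lambda>a. dir_deriv a q x"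
  have "rot_deriv a b p x * rot_deriv a b q x =
      (x \<bullet> a) * (x \<bullet> a) * (?P b * ?Q b) + (?P a * ?Q a) * ((x \<bullet> b) * (x \<bullet> b))
       - ((x \<bullet> a) * ?P a) * ((x \<bullet> b) * ?Q b) - ((x \<bullet> a) * ?Q a) * ((x \<bullet> b) * ?P b)" for a b
    by (simp add: rot_deriv_def algebra_simps)
  then have "(\<Sum>a\<in>Basis. \<Sum>b\<in>Basis. rot_deriv a b p x * rot_deriv a b q x)
     = (\<Sum>a\<in>Basis. (x \<bullet> a) * (x \<bullet> a)) * (\<Sum>b\<in>Basis. ?P b * ?Q b)
      + (\<Sum>b\<in>Basis. ?P b * ?Q b) * (\<Sum>a\<in>Basis. (x \<bullet> a) * (x \<bullet> a))
      - (\<Sum>a\<in>Basis. (x \<bullet> a) * ?P a) * (\<Sum>b\<in>Basis. (x \<bullet> b) * ?Q b)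
      - (\<Sum>a\<in>Basis. (x \<bullet> a) * ?Q a) * (\<Sum>b\<in>Basis. (x \<bullet> b) * ?P b)"
    by (simp only: sum_product sum.distrib sum_subtractf)
  also have "\<dots> = 2 * ((x \<bullet> x) * (grad p x \<bullet> grad q x) - real n * real m * p x * q x)"
    unfolding euler_homogeneous[OF p hp] euler_homogeneous[OF q hq] inner_grad_grad[symmetric]
      euclidean_inner[of x x, symmetric]
    by (simp add: algebra_simps)
  finally show ?thesis .
qed

text \<open>Twice the angular part of the Laplacian. The mixed second derivatives contribute
  \<open>n * (n - 1)\<close> and the first derivatives \<open>n * (DIM('a) - 1)\<close>. For
  harmonic \<open>p\<close> in dimension three this yields the eigenvalue
  \<open>- n * (n + 1)\<close> on the unit sphere.\<close>

lemma sum_rot_deriv_rot_deriv: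
  fixes p :: "'a::euclidean_space \<Rightarrow> real"
  assumes p: "real_polynomial_function p" and hom: "\<And>t x. p (t *\<^sub>R x) = t ^ n * p x"
  shows "(\<Sum>a\<in>Basis. \<Sum>b\<in>Basis. rot_deriv a b (rot_deriv a b p) x)
           = 2 * ((x \<bullet> x) * laplacian p x - real n * (real n + real DIM('a) - 2) * p x)"
proof -
  let ?P = "\<lambda>a. dir_deriv a p x" and ?Q = "\<lambda>a b. dir_deriv a (dir_deriv b p) x"
  have D: "dir_deriv v (rot_deriv a b p) x =
      (x \<bullet> a) * ?Q v b + (v \<bullet> a) * ?P b - (x \<bullet> b) * ?Q v a - (v \<bullet> b) * ?P a" for a b v
    unfolding rot_deriv_def
    by (simp add: dir_deriv_diff dir_deriv_mult dir_deriv_inner_left polynomial_function_intros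
        real_polynomial_function_dir_deriv p)
  \<comment> \<open>For basis vectors the factor \<open>a \<bullet> b\<close> is a Kronecker delta,
    hence the \<open>if\<close>. The factors \<open>1\<close> turn the terms with a single index
    into products as well, so that summing over the other index produces the dimension.\<close>
  have "rot_deriv a b (rot_deriv a b p) x =
      (x \<bullet> a) * (x \<bullet> a) * ?Q b b + ?Q a a * ((x \<bullet> b) * (x \<bullet> b))
       - ((x \<bullet> a) * (x \<bullet> b) * ?Q b a) - ((x \<bullet> b) * (x \<bullet> a) * ?Q a b)
       + (if a = b then 2 * ((x \<bullet> a) * ?P a) else 0)
       - (x \<bullet> a) * ?P a * 1 - 1 * ((x \<bullet> b) * ?P b)" if "a \<in> Basis" "b \<in> Basis" for a b
    unfolding rot_deriv_def[of a b "rot_deriv a b p"] D using that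
    by (simp add: inner_Basis algebra_simps)
  then have "(\<Sum>a\<in>Basis. \<Sum>b\<in>Basis. rot_deriv a b (rot_deriv a b p) x)
     = (\<Sum>a\<in>Basis. \<Sum>b\<in>Basis. (x \<bullet> a) * (x \<bullet> a) * ?Q b b + ?Q a a * ((x \<bullet> b) * (x \<bullet> b))
       - ((x \<bullet> a) * (x \<bullet> b) * ?Q b a) - ((x \<bullet> b) * (x \<bullet> a) * ?Q a b)
       + (if a = b then 2 * ((x \<bullet> a) * ?P a) else 0)
       - (x \<bullet> a) * ?P a * 1 - 1 * ((x \<bullet> b) * ?P b))"
    by simp
  also have "\<dots> = (\<Sum>a\<in>Basis. (x \<bullet> a) * (x \<bullet> a)) * (\<Sum>b\<in>Basis. ?Q b b)
      + (\<Sum>b\<in>Basis. ?Q b b) * (\<Sum>a\<in>Basis. (x \<bullet> a) * (x \<bullet> a))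
      - (\<Sum>a\<in>Basis. \<Sum>b\<in>Basis. (x \<bullet> a) * (x \<bullet> b) * ?Q b a)
      - (\<Sum>a\<in>Basis. \<Sum>b\<in>Basis. (x \<bullet> b) * (x \<bullet> a) * ?Q a b)
      + (\<Sum>a\<in>Basis. 2 * ((x \<bullet> a) * ?P a))
      - (\<Sum>a\<in>Basis. (x \<bullet> a) * ?P a) * (\<Sum>b\<in>(Basis::'a set). 1)
      - (\<Sum>b\<in>(Basis::'a set). 1) * (\<Sum>b\<in>Basis. (x \<bullet> b) * ?P b)"
    by (simp only: sum_product sum.distrib sum_subtractf) simp
  \<comment> \<open>The two mixed sums differ only in the names of their indices.\<close>
  also have "(\<Sum>a\<in>Basis. \<Sum>b\<in>Basis. (x \<bullet> b) * (x \<bullet> a) * ?Q a b)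
      = (\<Sum>a\<in>Basis. \<Sum>b\<in>Basis. (x \<bullet> a) * (x \<bullet> b) * ?Q b a)"
    by (rule sum.swap)
  also have "(\<Sum>a\<in>Basis. 2 * ((x \<bullet> a) * ?P a)) = 2 * (\<Sum>a\<in>Basis. (x \<bullet> a) * ?P a)"
    by (rule sum_distrib_left[symmetric])
  finally show ?thesis
    unfolding euler_homogeneous[OF assms] euler_homogeneous2[OF assms] laplacian_polynomial[OF p]
      euclidean_inner[of x x, symmetric]
    by (simp add: algebra_simps)
qed

section \<open>The surface measure\<close>

lemma space_sphere_measure: "space sphere_measure = unit_sphere"
  by (simp add: sphere_measure_def space_scale_measure space_restrict_space)

lemma sets_sphere_measure [measurable_cong]: "sets sphere_measure = sets (restrict_space borel unit_sphere)"
  by (simp add: sphere_measure_def)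

lemma measurable_sgn_ball:
  "sgn \<in> restrict_space lborel (ball 0 1 - {0}) \<rightarrow>\<^sub>M restrict_space borel unit_sphere"
proof (rule measurable_restrict_space3)
  show "sgn \<in> lborel \<rightarrow>\<^sub>M (borel :: (real^3) measure)"
    unfolding sgn_div_norm[abs_def] by measurable
qed (auto simp: norm_sgn)

lemma emeasure_sphere_measure:
  assumes "A \<in> sets sphere_measure"
  shows "emeasure sphere_measure A = 3 * emeasure lborel {x \<in> ball 0 1 - {0}. sgn x \<in> A}"
proof -
  have "emeasure sphere_measure A =
      3 * emeasure (restrict_space lborel (ball 0 1 - {0})) (sgn -` A \<inter> space (restrict_space lborel (ball 0 1 - {0})))"
    using assms unfolding sphere_measure_def
    by (simp add: emeasure_distr[OF measurable_sgn_ball])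
  also have "sgn -` A \<inter> space (restrict_space lborel (ball 0 1 - {0})) = {x \<in> ball 0 1 - {0}. sgn x \<in> A}"
    by (auto simp: space_restrict_space)
  also have "emeasure (restrict_space lborel (ball 0 1 - {0})) \<dots> = emeasure lborel \<dots>"
    by (rule emeasure_restrict_space) auto
  finally show ?thesis .
qed

lemma finite_measure_sphere_measure: "finite_measure sphere_measure"
proof
  have "emeasure sphere_measure (space sphere_measure) \<le> 3 * emeasure lborel (ball (0::real^3) 1)"
    unfolding emeasure_sphere_measure[OF sets.top]
    by (intro mult_left_mono emeasure_mono) auto
  also have "\<dots> < \<infinity>"
    using emeasure_lborel_ball_finite[of "0::real^3" 1] by (simp add: ennreal_mult_less_top)
  finally show "emeasure sphere_measure (space sphere_measure) \<noteq> \<infinity>" by simp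
qed

lemma continuous_measurable_sphere_measure:
  fixes f :: "real^3 \<Rightarrow> 'b::euclidean_space"
  assumes "continuous_on unit_sphere f"
  shows "f \<in> borel_measurable sphere_measure"
  using borel_measurable_continuous_on_restrict[OF assms]
  by (simp cong: measurable_cong_sets add: sets_sphere_measure)

lemma continuous_integrable_sphere_measure:
  fixes f :: "real^3 \<Rightarrow> 'b::euclidean_space"
  assumes "continuous_on unit_sphere f"
  shows "integrable sphere_measure f"
proof -
  interpret finite_measure sphere_measure by (rule finite_measure_sphere_measure)
  obtain B where "\<forall>x\<in>unit_sphere. norm (f x) \<le> B"
    using compact_imp_bounded[OF compact_continuous_image[OF assms compact_sphere]]
    by (auto simp: bounded_iff)
  then show ?thesis
    by (intro integrable_const_bound[of _ B] AE_I2 continuous_measurable_sphere_measure[OF assms])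
       (auto simp: space_sphere_measure)
qed

section \<open>Invariance of the measures under orthogonal maps\<close>

lemma borel_measurable_orthogonal_transformation:
  fixes f :: "'a::euclidean_space \<Rightarrow> 'a"
  assumes "orthogonal_transformation f"
  shows "f \<in> borel_measurable borel"
  using assms by (intro borel_measurable_continuous_onI linear_continuous_on
      linear_conv_bounded_linear[THEN iffD1] orthogonal_transformation_linear)

text \<open>Lebesgue measure is determined by its values on boxes. The preimage of a box is its
  image under the inverse map, which is again orthogonal and therefore preserves volume.\<close>

lemma distr_lborel_orthogonal_transformation:
  fixes f :: "real^'n::{finite,wellorder} \<Rightarrow> real^'n::_"
  assumes f: "orthogonal_transformation f"
  shows "distr lborel borel f = lborel"
proof (rule lborel_eqI[symmetric])
  fix l u :: "real^'n::_" assume lu: "\<And>b. b \<in> Basis \<Longrightarrow> l \<bullet> b \<le> u \<bullet> b"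
  have fm[measurable]: "f \<in> borel_measurable borel"
    by (rule borel_measurable_orthogonal_transformation[OF f])
  have v: "f -` box l u = inv f ` box l u"
    using orthogonal_transformation_bij[OF f] by (simp add: bij_vimage_eq_inv_image)
  have g: "orthogonal_transformation (inv f)"
    by (rule orthogonal_transformation_inv[OF f])
  have m: "f -` box l u \<in> sets borel"
    using measurable_sets[OF fm, of "box l u"] by simp
  have "emeasure (distr lborel borel f) (box l u) = emeasure lborel (f -` box l u)"
    by (simp add: emeasure_distr)
  also have "\<dots> = emeasure lebesgue (inv f ` box l u)"
    using m by (simp add: emeasure_completion v)
  also have "\<dots> = ennreal (measure lebesgue (inv f ` box l u))"
    by (intro emeasure_eq_measure2 measurable_orthogonal_image g lmeasurable_box)
  also have "\<dots> = emeasure lebesgue (box l u)"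
    by (simp add: measure_orthogonal_image g emeasure_eq_measure2)
  also have "\<dots> = (\<Prod>b\<in>Basis. (u - l) \<bullet> b)"
    using lu by (simp add: emeasure_completion)
  finally show "emeasure (distr lborel borel f) (box l u) = (\<Prod>b\<in>Basis. (u - l) \<bullet> b)" .
qed simp

lemma orthogonal_transformation_sgn:
  fixes f :: "'a::euclidean_space \<Rightarrow> 'a"
  assumes f: "orthogonal_transformation f"
  shows "f (sgn x) = sgn (f x)"
  using linear_scale[OF orthogonal_transformation_linear[OF f]]
  by (simp add: sgn_div_norm orthogonal_transformation_norm[OF f])

lemma measurable_orthogonal_transformation_sphere:
  assumes f: "orthogonal_transformation f"
  shows "f \<in> sphere_measure \<rightarrow>\<^sub>M sphere_measure"
proof -
  have "f \<in> borel_measurable borel"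
    by (rule borel_measurable_orthogonal_transformation[OF f])
  then have "f \<in> restrict_space borel unit_sphere \<rightarrow>\<^sub>M restrict_space borel unit_sphere"
    by (rule measurable_restrict_space3) (auto simp: orthogonal_transformation_norm[OF f])
  then show ?thesis
    by (simp cong: measurable_cong_sets add: sets_sphere_measure)
qed

text \<open>An orthogonal map commutes with \<open>sgn\<close> and preserves the punctured ball, so
  the cone over a preimage is the preimage of the cone. The claim thus reduces to the invariance of
  Lebesgue measure.\<close>

lemma distr_sphere_measure_orthogonal_transformation:
  assumes f: "orthogonal_transformation f"
  shows "distr sphere_measure sphere_measure f = sphere_measure"
proof (rule measure_eqI)
  fix A assume "A \<in> sets (distr sphere_measure sphere_measure f)"
  then have A: "A \<in> sets sphere_measure" by simp
  note fm = measurable_orthogonal_transformation_sphere[OF f]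
  have fb[measurable]: "f \<in> borel_measurable borel"
    by (rule borel_measurable_orthogonal_transformation[OF f])
  let ?C = "{x \<in> ball 0 1 - {0}. sgn x \<in> A}"
  have C: "?C \<in> sets borel"
  proof -
    have "sgn -` A \<inter> space (restrict_space lborel (ball 0 1 - {0})) \<in> sets (restrict_space lborel (ball (0::real^3) 1 - {0}))"
      using A by (intro measurable_sets[OF measurable_sgn_ball]) (simp add: sets_sphere_measure)
    then have "sgn -` A \<inter> (ball 0 1 - {0}) \<in> sets borel"
      by (subst (asm) sets_restrict_space_iff) (auto simp: space_restrict_space)
    moreover have "sgn -` A \<inter> (ball 0 1 - {0}) = ?C" by auto
    ultimately show ?thesis by simp
  qed
  have "emeasure (distr sphere_measure sphere_measure f) A
      = emeasure sphere_measure (f -` A \<inter> space sphere_measure)"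
    by (rule emeasure_distr[OF fm A])
  also have "\<dots> = 3 * emeasure lborel {x \<in> ball 0 1 - {0}. sgn x \<in> f -` A \<inter> space sphere_measure}"
    by (rule emeasure_sphere_measure[OF measurable_sets[OF fm A]])
  also have "{x \<in> ball 0 1 - {0}. sgn x \<in> f -` A \<inter> space sphere_measure} = f -` ?C"
    using linear_0[OF orthogonal_transformation_linear[OF f]] orthogonal_transformation_norm[OF f]
    by (auto simp: space_sphere_measure norm_sgn orthogonal_transformation_sgn[OF f])
      (metis norm_eq_zero)+
  also have "emeasure lborel (f -` ?C) = emeasure (distr lborel borel f) ?C"
    using C by (simp add: emeasure_distr)
  also have "\<dots> = emeasure lborel ?C"
    by (simp add: distr_lborel_orthogonal_transformation[OF f])
  also have "3 * \<dots> = emeasure sphere_measure A"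
    by (rule emeasure_sphere_measure[OF A, symmetric])
  finally show "emeasure (distr sphere_measure sphere_measure f) A = emeasure sphere_measure A" .
qed simp

section \<open>Rotations of a coordinate plane and their generators\<close>

definition plane_rotation :: "'a::euclidean_space \<Rightarrow> 'a \<Rightarrow> real \<Rightarrow> 'a \<Rightarrow> 'a" where
  "plane_rotation a b t x = x + ((cos t - 1) * (x \<bullet> a) - sin t * (x \<bullet> b)) *\<^sub>R a
                              + (sin t * (x \<bullet> a) + (cos t - 1) * (x \<bullet> b)) *\<^sub>R b"

lemma orthogonal_transformation_plane_rotation:
  assumes ab: "a \<in> Basis" "b \<in> Basis" "a \<noteq> b"
  shows "orthogonal_transformation (plane_rotation a b t)"
  unfolding orthogonal_transformation_def
proof safe
  show "linear (plane_rotation a b t)"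
    by (rule linearI) (simp_all add: plane_rotation_def algebra_simps)
  fix v w :: 'a
  have [simp]: "a \<bullet> b = 0" "b \<bullet> a = 0" "a \<bullet> a = 1" "b \<bullet> b = 1"
    using ab by (auto simp: inner_Basis)
  \<comment> \<open>Orthonormality of \<open>a\<close> and \<open>b\<close> makes the inner product
    a polynomial in coordinates and coefficients; the Pythagorean identity for \<open>sin\<close>
    and \<open>cos\<close> then settles the claim.\<close>
  have e: "(v + p *\<^sub>R a + q *\<^sub>R b) \<bullet> (w + r *\<^sub>R a + s *\<^sub>R b)
      = v \<bullet> w + p * (w \<bullet> a) + q * (w \<bullet> b) + r * (v \<bullet> a) + s * (v \<bullet> b) + p * r + q * s" for p q r s
    by (simp add: algebra_simps inner_commute)
  have "sin t * sin t = 1 - cos t * cos t"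
    using sin_cos_squared_add[of t] by (simp add: power2_eq_square)
  then show "plane_rotation a b t v \<bullet> plane_rotation a b t w = v \<bullet> w"
    unfolding plane_rotation_def e by algebra
qed

text \<open>The velocity of the rotating point at every time \<open>t\<close> is the generator
  evaluated at the current position \<open>plane_rotation a b t x\<close>; the chain rule does the
  rest.\<close>

lemma DERIV_plane_rotation:
  fixes p :: "'a::euclidean_space \<Rightarrow> real"
  assumes p: "real_polynomial_function p" and ab: "a \<in> Basis" "b \<in> Basis" "a \<noteq> b"
  shows "((\<lambda>t. p (plane_rotation a b t x)) has_real_derivative rot_deriv a b p (plane_rotation a b t x)) (at t)"
proof -
  let ?y = "plane_rotation a b t x"
  have [simp]: "a \<bullet> b = 0" "b \<bullet> a = 0" "a \<bullet> a = 1" "b \<bullet> b = 1"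
    using ab by (auto simp: inner_Basis)
  have y: "?y \<bullet> a = cos t * (x \<bullet> a) - sin t * (x \<bullet> b)" "?y \<bullet> b = sin t * (x \<bullet> a) + cos t * (x \<bullet> b)"
    by (simp_all add: plane_rotation_def algebra_simps)
  have r: "((\<lambda>t. plane_rotation a b t x) has_derivative (\<lambda>h. h *\<^sub>R ((?y \<bullet> a) *\<^sub>R b - (?y \<bullet> b) *\<^sub>R a))) (at t)"
    unfolding y unfolding plane_rotation_def
    by (auto intro!: derivative_eq_intros simp: algebra_simps)
  have "((\<lambda>t. p (plane_rotation a b t x)) has_derivative
      (\<lambda>h. dir_deriv (h *\<^sub>R ((?y \<bullet> a) *\<^sub>R b - (?y \<bullet> b) *\<^sub>R a)) p ?y)) (at t)"
    by (rule has_derivative_compose[OF r polynomial_has_derivative[OF p]])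
  moreover have "dir_deriv (h *\<^sub>R ((?y \<bullet> a) *\<^sub>R b - (?y \<bullet> b) *\<^sub>R a)) p ?y = rot_deriv a b p ?y * h" for h
  proof -
    interpret linear "\<lambda>v. dir_deriv v p ?y" by (rule linear_dir_deriv[OF p])
    show ?thesis by (simp add: scaleR diff rot_deriv_def)
  qed
  ultimately show ?thesis
    by (simp add: has_field_derivative_def)
qed

text \<open>Rotation invariance of the surface measure, differentiated at the identity.\<close>

lemma integral_rot_deriv_sphere:
  assumes p: "real_polynomial_function p" and ab: "a \<in> Basis" "b \<in> Basis"
  shows "(\<integral>x. rot_deriv a b p x \<partial>sphere_measure) = 0"
proof (cases "a = b")
  case True
  then show ?thesis by (simp add: rot_deriv_def)
next
  case False
  let ?R = "plane_rotation a b" and ?t = "\<lambda>n. inverse (real (Suc n))"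
  let ?s = "\<lambda>n x. (p (?R (?t n) x) - p x) / ?t n"
  interpret finite_measure sphere_measure by (rule finite_measure_sphere_measure)
  have R: "orthogonal_transformation (?R t)" for t
    by (rule orthogonal_transformation_plane_rotation[OF ab False])
  have pm[measurable]: "p \<in> borel_measurable sphere_measure"
    by (intro continuous_measurable_sphere_measure continuous_on_real_polynomial_function p)
  have pint: "integrable sphere_measure p"
    by (intro continuous_integrable_sphere_measure continuous_on_real_polynomial_function p)
  note Rm[measurable] = measurable_orthogonal_transformation_sphere[OF R]
  have Rint: "integrable sphere_measure (\<lambda>x. p (?R t x))" for t
    using integrable_distr_eq[OF Rm pm, of t]
    by (simp add: distr_sphere_measure_orthogonal_transformation[OF R] pint)
  have Req: "(\<integral>x. p (?R t x) \<partial>sphere_measure) = (\<integral>x. p x \<partial>sphere_measure)" for t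
    using integral_distr[OF Rm pm, of t]
    by (simp add: distr_sphere_measure_orthogonal_transformation[OF R])
  have cont: "continuous_on unit_sphere (rot_deriv a b p)"
    by (intro continuous_on_real_polynomial_function real_polynomial_function_rot_deriv p)
  obtain B where B: "\<forall>x\<in>unit_sphere. \<bar>rot_deriv a b p x\<bar> \<le> B"
    using compact_imp_bounded[OF compact_continuous_image[OF cont compact_sphere]]
    by (auto simp: bounded_iff)
  \<comment> \<open>By the mean value theorem the difference quotient is a value of
    \<open>rot_deriv a b p\<close> at a rotated point, which still lies on the sphere. The maximum
    there dominates all quotients at once.\<close>
  have bound: "\<bar>?s n x\<bar> \<le> B" if x: "x \<in> unit_sphere" for n x
  proof -
    have "\<exists>z. 0 < z \<and> z < ?t n \<and> p (?R (?t n) x) - p (?R 0 x) = (?t n - 0) * rot_deriv a b p (?R z x)"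
      by (intro MVT2 DERIV_plane_rotation[OF p ab False]) auto
    moreover have "?R 0 x = x" by (simp add: plane_rotation_def)
    ultimately obtain z where "?s n x = rot_deriv a b p (?R z x)" by auto
    moreover have "?R z x \<in> unit_sphere"
      using x by (simp add: orthogonal_transformation_norm[OF R])
    ultimately show ?thesis using B by metis
  qed
  have lim: "(\<lambda>n. ?s n x) \<longlonglongrightarrow> rot_deriv a b p x" for x
  proof -
    have R0: "?R 0 x = x" by (simp add: plane_rotation_def)
    have "((\<lambda>h. (p (?R (0 + h) x) - p (?R 0 x)) / h) \<longlongrightarrow> rot_deriv a b p (?R 0 x)) (at 0)"
      using DERIV_plane_rotation[OF p ab False, of x 0] by (simp only: DERIV_def)
    then have "((\<lambda>h. (p (?R h x) - p x) / h) \<longlongrightarrow> rot_deriv a b p x) (at 0)"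
      by (simp add: R0)
    moreover have "filterlim ?t (at 0) sequentially"
      using LIMSEQ_inverse_real_of_nat by (simp add: filterlim_at del: of_nat_Suc)
    ultimately show ?thesis
      by (rule filterlim_compose)
  qed
  have "(\<lambda>n. \<integral>x. ?s n x \<partial>sphere_measure) \<longlonglongrightarrow> (\<integral>x. rot_deriv a b p x \<partial>sphere_measure)"
  proof (rule integral_dominated_convergence[where w = "\<lambda>_. B"])
    show "rot_deriv a b p \<in> borel_measurable sphere_measure"
      by (rule continuous_measurable_sphere_measure[OF cont])
    show "AE x in sphere_measure. norm (?s n x) \<le> B" for n
      using bound by (intro AE_I2) (simp add: space_sphere_measure)
  qed (use lim in auto)
  \<comment> \<open>Rotation invariance gives both terms of the difference quotient the same
    integral.\<close>
  moreover have "(\<integral>x. ?s n x \<partial>sphere_measure) = 0" for n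
    using Rint pint Req by simp
  ultimately show ?thesis
    by (simp add: LIMSEQ_const_iff)
qed

text \<open>Green's identity on the sphere: the integral of the summed fields \<open>?F a b\<close>
  vanishes. The factor is \<open>m * (m + 1)\<close> from the angular Laplacian of the harmonic
  \<open>q\<close> plus \<open>n * m\<close> from the radial parts of the two gradients.\<close>

lemma integral_grad_inner_grad:
  assumes p: "real_polynomial_function p" and hp: "\<And>t x. p (t *\<^sub>R x) = t ^ n * p x"
    and q: "real_polynomial_function q" and hq: "\<And>t x. q (t *\<^sub>R x) = t ^ m * q x"
    and harm: "\<And>x. laplacian q x = 0"
  shows "(\<integral>x. grad p x \<bullet> grad q x \<partial>sphere_measure)
           = real m * (real n + real m + 1) * (\<integral>x. p x * q x \<partial>sphere_measure)"
proof -
  let ?F = "\<lambda>a b x. rot_deriv a b (\<lambda>x. p x * rot_deriv a b q x) x"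
  have int: "integrable sphere_measure f" if "real_polynomial_function f" for f
    by (intro continuous_integrable_sphere_measure continuous_on_real_polynomial_function that)
  have F: "integrable sphere_measure (?F a b)" for a b
    using p q by (intro int real_polynomial_function_rot_deriv polynomial_function_intros)
  have "?F a b x = p x * rot_deriv a b (rot_deriv a b q) x + rot_deriv a b p x * rot_deriv a b q x" for a b x
    by (intro rot_deriv_mult p real_polynomial_function_rot_deriv q)
  then have "(\<Sum>a\<in>Basis. \<Sum>b\<in>Basis. ?F a b x) =
      p x * (\<Sum>a\<in>Basis. \<Sum>b\<in>Basis. rot_deriv a b (rot_deriv a b q) x)
      + (\<Sum>a\<in>Basis. \<Sum>b\<in>Basis. rot_deriv a b p x * rot_deriv a b q x)" for x
    by (simp add: sum.distrib sum_distrib_left)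
  then have *: "(\<Sum>a\<in>Basis. \<Sum>b\<in>Basis. ?F a b x) =
      2 * (grad p x \<bullet> grad q x - real m * (real n + real m + 1) * (p x * q x))"
    if "x \<in> space sphere_measure" for x
    unfolding sum_rot_deriv_rot_deriv[OF q hq] sum_rot_deriv_mult_rot_deriv[OF p hp q hq]
    using that by (simp add: harm space_sphere_measure dot_square_norm algebra_simps)
  have i1: "integrable sphere_measure (\<lambda>x. grad p x \<bullet> grad q x)"
    unfolding inner_grad_grad
    by (intro int polynomial_function_intros real_polynomial_function_dir_deriv p q finite_Basis)
  have i2: "integrable sphere_measure (\<lambda>x. p x * q x)"
    by (intro int polynomial_function_intros p q)
  have "0 = (\<Sum>a\<in>Basis. \<Sum>b\<in>Basis. \<integral>x. ?F a b x \<partial>sphere_measure)"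
    using p q by (simp add: integral_rot_deriv_sphere real_polynomial_function.intros(4) real_polynomial_function_rot_deriv)
  also have "\<dots> = (\<integral>x. (\<Sum>a\<in>Basis. \<Sum>b\<in>Basis. ?F a b x) \<partial>sphere_measure)"
    using F by (simp add: Bochner_Integration.integral_sum Bochner_Integration.integrable_sum)
  also have "\<dots> = (\<integral>x. 2 * (grad p x \<bullet> grad q x - real m * (real n + real m + 1) * (p x * q x)) \<partial>sphere_measure)"
    by (intro Bochner_Integration.integral_cong *) auto
  also have "\<dots> = 2 * ((\<integral>x. grad p x \<bullet> grad q x \<partial>sphere_measure)
      - real m * (real n + real m + 1) * (\<integral>x. p x * q x \<partial>sphere_measure))"
    using i1 i2 by simp
  finally show ?thesis by simp
qed

section \<open>Square-integrable functions\<close>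

lemma norm_diff_square_le: "(norm (a - b))\<^sup>2 \<le> 2 * (norm a)\<^sup>2 + 2 * (norm b)\<^sup>2"
  for a b :: "'a::real_inner"
  using zero_le_power2[of "norm (a + b)"]
  by (simp add: power2_norm_eq_inner algebra_simps inner_commute)

lemma L2_diff:
  assumes "f \<in> L2 M" "g \<in> L2 M"
  shows "(\<lambda>x. f x - g x) \<in> L2 M"
proof -
  have [measurable]: "f \<in> borel_measurable M" "g \<in> borel_measurable M"
    using assms by (auto simp: L2_def)
  have "integrable M (\<lambda>x. (norm (f x - g x))\<^sup>2)"
  proof (rule Bochner_Integration.integrable_bound)
    show "integrable M (\<lambda>x. 2 * (norm (f x))\<^sup>2 + 2 * (norm (g x))\<^sup>2)"
      using assms by (auto simp: L2_def)
  qed (auto intro!: AE_I2 norm_diff_square_le)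
  then show ?thesis by (simp add: L2_def)
qed

lemma integral_norm_diff_square_le:
  assumes "f \<in> L2 M" "g \<in> L2 M"
  shows "(\<integral>x. (norm (f x - g x))\<^sup>2 \<partial>M) \<le> 2 * (\<integral>x. (norm (f x))\<^sup>2 \<partial>M) + 2 * (\<integral>x. (norm (g x))\<^sup>2 \<partial>M)"
proof -
  have "(\<integral>x. (norm (f x - g x))\<^sup>2 \<partial>M) \<le> (\<integral>x. 2 * (norm (f x))\<^sup>2 + 2 * (norm (g x))\<^sup>2 \<partial>M)"
    using assms L2_diff[OF assms] by (intro integral_mono norm_diff_square_le) (auto simp: L2_def)
  also have "\<dots> = 2 * (\<integral>x. (norm (f x))\<^sup>2 \<partial>M) + 2 * (\<integral>x. (norm (g x))\<^sup>2 \<partial>M)"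
    using assms by (simp add: L2_def)
  finally show ?thesis .
qed

lemma L2_norm_less_iff: "0 < e \<Longrightarrow> L2_norm M f < e \<longleftrightarrow> (\<integral>x. (norm (f x))\<^sup>2 \<partial>M) < e\<^sup>2"
  by (metis L2_norm_def abs_of_pos real_sqrt_abs real_sqrt_less_iff)

text \<open>The Riesz-Fischer argument at a geometric rate: the consecutive differences are summable
  in the mean, so the telescoping series converges almost everywhere, and Fatou's lemma carries the
  quadratic estimate over to the pointwise limit.\<close>

lemma L2_complete_rapidly_Cauchy:
  fixes u :: "nat \<Rightarrow> 'a \<Rightarrow> 'b::euclidean_space"
  assumes fin: "finite_measure M" and u: "\<And>k. u k \<in> L2 M"
    and C: "\<And>k m. k \<le> m \<Longrightarrow> (\<integral>x. (norm (u k x - u m x))\<^sup>2 \<partial>M) \<le> C * (1/4) ^ k"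
  obtains f where "f \<in> L2 M" "\<And>k. (\<integral>x. (norm (u k x - f x))\<^sup>2 \<partial>M) \<le> C * (1/4) ^ k"
proof -
  interpret finite_measure M by (rule fin)
  have um[measurable]: "u k \<in> borel_measurable M" for k
    using u by (simp add: L2_def)
  have C0: "0 \<le> C" using C[of 0 0] by simp
  let ?d = "\<lambda>k x. norm (u k x - u (Suc k) x)"
  have dsq: "integrable M (\<lambda>x. (?d k x)\<^sup>2)" for k
    using L2_diff[OF u u, of k "Suc k"] by (simp add: L2_def)
  \<comment> \<open>Weighted arithmetic-geometric mean inequality. The weight \<open>2 ^ k\<close>
    balances the constant term, whose integral is finite since the measure is, against the quadratic
    one of order \<open>(1/4) ^ k\<close>; both become of order \<open>(1/2) ^ k\<close>.\<close>
  have w: "?d k x \<le> ((1/2) ^ k + 2 ^ k * (?d k x)\<^sup>2) / 2" for k x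
  proof -
    have "0 \<le> (1/2) ^ k * (1 - 2 ^ k * ?d k x)\<^sup>2" by simp
    also have "\<dots> = (1/2) ^ k - 2 * ?d k x + 2 ^ k * (?d k x)\<^sup>2"
      by (simp add: power2_eq_square algebra_simps power_one_over)
    finally show ?thesis by simp
  qed
  have wint: "integrable M (\<lambda>x. ((1/2) ^ k + 2 ^ k * (?d k x)\<^sup>2) / 2)" for k
    using dsq by auto
  have dint: "integrable M (?d k)" for k
  proof (rule Bochner_Integration.integrable_bound[OF wint[of k]])
    show "AE x in M. norm (?d k x) \<le> norm (((1/2) ^ k + 2 ^ k * (?d k x)\<^sup>2) / 2)"
      unfolding real_norm_def abs_norm_cancel by (intro AE_I2 order_trans[OF w[of k] abs_ge_self])
  qed measurable
  have dle: "(\<integral>x. ?d k x \<partial>M) \<le> (measure M (space M) + C) / 2 * (1/2) ^ k" for k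
  proof -
    have "(\<integral>x. ?d k x \<partial>M) \<le> (\<integral>x. ((1/2) ^ k + 2 ^ k * (?d k x)\<^sup>2) / 2 \<partial>M)"
      by (rule integral_mono[OF dint wint w])
    also have "\<dots> = ((1/2) ^ k * measure M (space M) + 2 ^ k * (\<integral>x. (?d k x)\<^sup>2 \<partial>M)) / 2"
      using dsq by simp
    also have "\<dots> \<le> ((1/2) ^ k * measure M (space M) + 2 ^ k * (C * (1/4) ^ k)) / 2"
      using C[of k "Suc k"] by simp
    also have "2 ^ k * (C * (1/4) ^ k) = C * (1/2) ^ k"
      by (simp add: power_mult_distrib[symmetric])
    finally show ?thesis by (simp add: algebra_simps)
  qed
  have "summable (\<lambda>k. \<integral>x. ?d k x \<partial>M)"
  proof (rule summable_comparison_test')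
    show "summable (\<lambda>k. (measure M (space M) + C) / 2 * (1/2) ^ k)"
      by (intro summable_mult summable_geometric) simp
    show "norm (\<integral>x. ?d k x \<partial>M) \<le> (measure M (space M) + C) / 2 * (1/2) ^ k" if "0 \<le> k" for k
      using dle[of k] by simp
  qed
  then have "(\<integral>\<^sup>+x. (\<Sum>k. ennreal (?d k x)) \<partial>M) \<noteq> \<infinity>"
    by (subst nn_integral_suminf) (auto simp: nn_integral_eq_integral[OF dint] suminf_ennreal2)
  then have "AE x in M. (\<Sum>k. ennreal (?d k x)) \<noteq> \<infinity>"
    by (intro nn_integral_PInf_AE) auto
  then have conv: "AE x in M. convergent (\<lambda>k. u k x)"
  proof eventually_elim
    case (elim x)
    then have "summable (\<lambda>k. ?d k x)"
      by (intro summable_suminf_not_top) auto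
    then have "summable (\<lambda>k. norm (u (Suc k) x - u k x))"
      by (simp add: norm_minus_commute)
    then have "summable (\<lambda>k. u (Suc k) x - u k x)"
      by (rule summable_norm_cancel)
    then have "convergent (\<lambda>n. u n x - u 0 x)"
      by (simp add: summable_iff_convergent sum_lessThan_telescope[of "\<lambda>n. u n x"])
    then show ?case
      by (simp add: convergent_diff_const_right_iff)
  qed
  \<comment> \<open>Where the sequence diverges, which happens only on a null set,
    \<open>lim\<close> takes some default value.\<close>
  define f where "f = (\<lambda>x. lim (\<lambda>k. u k x))"
  have fm[measurable]: "f \<in> borel_measurable M"
    unfolding f_def by measurable
  \<comment> \<open>With \<open>k\<close> fixed, the squared distance to \<open>f\<close> is almost
    everywhere the limit over \<open>m\<close> of the squared distances to \<open>u m\<close>, and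
    the bound assumed for those is uniform in \<open>m\<close>.\<close>
  have fatou: "(\<integral>\<^sup>+x. ennreal ((norm (u k x - f x))\<^sup>2) \<partial>M) \<le> ennreal (C * (1/4) ^ k)" for k
  proof -
    have "AE x in M. ennreal ((norm (u k x - f x))\<^sup>2) = liminf (\<lambda>m. ennreal ((norm (u k x - u m x))\<^sup>2))"
      using conv
    proof eventually_elim
      case (elim x)
      then have "(\<lambda>m. u m x) \<longlonglongrightarrow> f x"
        by (simp add: f_def convergent_LIMSEQ_iff)
      then have "(\<lambda>m. ennreal ((norm (u k x - u m x))\<^sup>2)) \<longlonglongrightarrow> ennreal ((norm (u k x - f x))\<^sup>2)"
        by (intro tendsto_intros)
      then show ?case
        by (rule lim_imp_Liminf[OF trivial_limit_sequentially, symmetric])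
    qed
    then have "(\<integral>\<^sup>+x. ennreal ((norm (u k x - f x))\<^sup>2) \<partial>M)
        = (\<integral>\<^sup>+x. liminf (\<lambda>m. ennreal ((norm (u k x - u m x))\<^sup>2)) \<partial>M)"
      by (rule nn_integral_cong_AE)
    also have "\<dots> \<le> liminf (\<lambda>m. \<integral>\<^sup>+x. ennreal ((norm (u k x - u m x))\<^sup>2) \<partial>M)"
      by (intro nn_integral_liminf) auto
    also have "\<dots> \<le> ennreal (C * (1/4) ^ k)"
    proof (rule Liminf_le)
      have "(\<integral>\<^sup>+x. ennreal ((norm (u k x - u m x))\<^sup>2) \<partial>M) \<le> ennreal (C * (1/4) ^ k)" if "k \<le> m" for m
        using L2_diff[OF u u, of k m] C[OF that]
        by (subst nn_integral_eq_integral) (auto simp: L2_def intro!: ennreal_leI)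
      then show "\<forall>\<^sub>F m in sequentially. (\<integral>\<^sup>+x. ennreal ((norm (u k x - u m x))\<^sup>2) \<partial>M) \<le> ennreal (C * (1/4) ^ k)"
        by (auto simp: eventually_sequentially)
    qed simp
    finally show ?thesis .
  qed
  have int: "integrable M (\<lambda>x. (norm (u k x - f x))\<^sup>2)" for k
    using fatou[of k] by (intro integrableI_bounded) (auto intro: le_less_trans)
  show ?thesis
  proof
    have "(\<lambda>x. u 0 x - f x) \<in> L2 M"
      using int by (simp add: L2_def)
    from L2_diff[OF u[of 0] this] show "f \<in> L2 M" by simp
    show "(\<integral>x. (norm (u k x - f x))\<^sup>2 \<partial>M) \<le> C * (1/4) ^ k" for k
      using fatou[of k] C0 by (subst (asm) nn_integral_eq_integral[OF int]) auto
  qed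
qed

section \<open>Finite orthogonal sums and spans\<close>

lemma integral_norm_square_sum_orthogonal:
  fixes G :: "'i \<Rightarrow> 'a \<Rightarrow> 'b::euclidean_space"
  assumes int: "\<And>i j. i \<in> J \<Longrightarrow> j \<in> J \<Longrightarrow> integrable M (\<lambda>x. G i x \<bullet> G j x)"
    and orth: "\<And>i j. i \<in> J \<Longrightarrow> j \<in> J \<Longrightarrow> L2_inner M (G i) (G j) = (if i = j then e i else 0)"
  shows "(\<integral>x. (norm (\<Sum>j\<in>J. c j *\<^sub>R G j x))\<^sup>2 \<partial>M) = (\<Sum>j\<in>J. (c j)\<^sup>2 * e j)"
proof (cases "finite J")
  case True
  have "(norm (\<Sum>j\<in>J. c j *\<^sub>R G j x))\<^sup>2 = (\<Sum>i\<in>J. \<Sum>j\<in>J. c i * c j * (G i x \<bullet> G j x))" for x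
    unfolding power2_norm_eq_inner inner_sum_left inner_sum_right
    by (intro sum.cong refl) (simp add: inner_commute)
  then have "(\<integral>x. (norm (\<Sum>j\<in>J. c j *\<^sub>R G j x))\<^sup>2 \<partial>M)
      = (\<integral>x. (\<Sum>i\<in>J. \<Sum>j\<in>J. c i * c j * (G i x \<bullet> G j x)) \<partial>M)"
    by simp
  also have "\<dots> = (\<Sum>i\<in>J. \<Sum>j\<in>J. c i * c j * L2_inner M (G i) (G j))"
    using int by (simp add: L2_inner_def Bochner_Integration.integral_sum Bochner_Integration.integrable_sum)
  also have "\<dots> = (\<Sum>i\<in>J. \<Sum>j\<in>J. if i = j then c i * c j * e i else 0)"
    by (intro sum.cong) (auto simp: orth)
  also have "\<dots> = (\<Sum>j\<in>J. (c j)\<^sup>2 * e j)"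
    using True by (simp add: power2_eq_square)
  finally show ?thesis .
\<comment> \<open>For an infinite index set all sums are \<open>0\<close> by convention.\<close>
qed simp

text \<open>\<open>fun_span\<close> has one coefficient per function, whereas distinct indices may
  name the same function; the coefficients of such indices are added up.\<close>

lemma fun_span_imageI:
  assumes J: "finite J" "F ` J \<subseteq> B"
  shows "(\<lambda>x. \<Sum>j\<in>J. c j *\<^sub>R F j x) \<in> fun_span B"
proof -
  have "(\<Sum>j\<in>J. c j *\<^sub>R F j x) = (\<Sum>b\<in>F ` J. (\<Sum>j\<in>{j\<in>J. F j = b}. c j) *\<^sub>R b x)" for x
    by (subst sum.image_gen[OF J(1), of _ F]) (auto simp: scaleR_sum_left intro!: sum.cong)
  then have "(\<lambda>x. \<Sum>j\<in>J. c j *\<^sub>R F j x) = (\<lambda>x. \<Sum>b\<in>F ` J. (\<Sum>j\<in>{j\<in>J. F j = b}. c j) *\<^sub>R b x)"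
    by (rule ext)
  moreover have "finite (F ` J)" using J(1) by simp
  ultimately show ?thesis
    unfolding fun_span_def mem_Collect_eq using J(2) by (intro exI conjI)
qed

text \<open>One index is picked for each function that occurs, so that \<open>F\<close> is injective
  on \<open>J\<close> and the sum can be reindexed.\<close>

lemma fun_span_imageE:
  assumes "f \<in> fun_span (F ` I)"
  obtains J c where "finite J" "J \<subseteq> I" "f = (\<lambda>x. \<Sum>j\<in>J. c j *\<^sub>R F j x)"
proof -
  obtain T c where T: "finite T" "T \<subseteq> F ` I" and f: "f = (\<lambda>x. \<Sum>b\<in>T. c b *\<^sub>R b x)"
    using assms unfolding fun_span_def by blast
  obtain J where J: "J \<subseteq> I" "inj_on F J" "T = F ` J"
    using T(2) unfolding subset_image_inj by blast
  show ?thesis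
  proof
    show "finite J" using T(1) J finite_image_iff by blast
    show "f = (\<lambda>x. \<Sum>j\<in>J. (c \<circ> F) j *\<^sub>R F j x)"
      unfolding f J(3) by (simp add: sum.reindex[OF J(2)])
  qed (rule J)
qed

text \<open>Padding with zero coefficients makes the difference of two finite combinations a single
  one over a common index set, the form to which the norm estimate for \<open>ext_part\<close>
  applies.\<close>

lemma sum_scaleR_diff_Un:
  fixes F :: "'i \<Rightarrow> 'b::real_vector"
  assumes "finite J" "finite K"
  shows "(\<Sum>j\<in>J. c j *\<^sub>R F j) - (\<Sum>j\<in>K. d j *\<^sub>R F j)
    = (\<Sum>j\<in>J \<union> K. ((if j \<in> J then c j else 0) - (if j \<in> K then d j else 0)) *\<^sub>R F j)"
proof -
  have "(\<Sum>j\<in>J. c j *\<^sub>R F j) = (\<Sum>j\<in>J \<union> K. (if j \<in> J then c j else 0) *\<^sub>R F j)"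
    using assms by (intro sum.mono_neutral_cong_left) auto
  moreover have "(\<Sum>j\<in>K. d j *\<^sub>R F j) = (\<Sum>j\<in>J \<union> K. (if j \<in> K then d j else 0) *\<^sub>R F j)"
    using assms by (intro sum.mono_neutral_cong_left) auto
  ultimately show ?thesis
    by (simp add: sum_subtractf scaleR_diff_left)
qed

lemma continuous_L2_sphere_measure:
  fixes f :: "real^3 \<Rightarrow> 'b::euclidean_space"
  assumes "continuous_on unit_sphere f"
  shows "f \<in> L2 sphere_measure"
  unfolding L2_def
  by (auto intro!: continuous_measurable_sphere_measure continuous_integrable_sphere_measure
      continuous_intros assms)

section \<open>Vector spherical harmonics\<close>

text \<open>At a unit vector \<open>x\<close> the derivative of \<open>sgn\<close> is the projection
  onto the tangent plane, so the surface gradient is \<open>grad p x\<close> without its radial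
  component. By Euler's identity that component is \<open>n * p x\<close>.\<close>

lemma surface_grad_homogeneous:
  assumes p: "real_polynomial_function p" and hom: "\<And>t x. p (t *\<^sub>R x) = t ^ n * p x"
    and Y: "\<And>x. x \<in> unit_sphere \<Longrightarrow> Y x = p x" and x: "x \<in> unit_sphere"
  shows "surface_grad Y x = grad p x - (real n * p x) *\<^sub>R x"
proof -
  have nx: "norm x = 1" and x0: "x \<noteq> 0" and sx: "sgn x = x"
    using x by (auto simp: sgn_div_norm)
  have rad: "x \<bullet> grad p x = real n * p x"
    by (simp only: euler_homogeneous[OF p hom] dir_deriv_expand[OF p, of x x]
        flip: dir_deriv_inner_grad[OF p])
  have N: "(norm has_derivative (\<lambda>h. h \<bullet> sgn x)) (at x)"
    by (rule has_derivative_norm[OF x0])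
  have s: "((\<lambda>y. inverse (norm y) *\<^sub>R y) has_derivative (\<lambda>h. h - (h \<bullet> x) *\<^sub>R x)) (at x)"
    using has_derivative_scaleR[OF Deriv.has_derivative_inverse[OF _ N] has_derivative_ident]
    by (simp add: nx sx x0)
  have "((\<lambda>y. p (inverse (norm y) *\<^sub>R y)) has_derivative
      (\<lambda>h. dir_deriv (h - (h \<bullet> x) *\<^sub>R x) p (inverse (norm x) *\<^sub>R x))) (at x)"
    by (rule has_derivative_compose[OF s polynomial_has_derivative[OF p]])
  moreover have "dir_deriv (h - (h \<bullet> x) *\<^sub>R x) p (inverse (norm x) *\<^sub>R x)
      = h \<bullet> (grad p x - (real n * p x) *\<^sub>R x)" for h
    by (simp add: nx dir_deriv_inner_grad[OF p] inner_diff_left inner_diff_right rad mult.commute)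
  ultimately have "((\<lambda>y. p (inverse (norm y) *\<^sub>R y)) has_derivative
      (\<lambda>h. h \<bullet> (grad p x - (real n * p x) *\<^sub>R x))) (at x)"
    by simp
  then have "((\<lambda>y. Y (sgn y)) has_derivative (\<lambda>h. h \<bullet> (grad p x - (real n * p x) *\<^sub>R x))) (at x)"
  proof (rule has_derivative_transform_within_open[where s = "- {0}"])
    show "p (inverse (norm y) *\<^sub>R y) = Y (sgn y)" if "y \<in> - {0}" for y
      using Y[of "sgn y"] that by (simp add: norm_sgn flip: sgn_div_norm)
  qed (use x0 in auto)
  then have g: "GDERIV (\<lambda>y. Y (sgn y)) x :> grad p x - (real n * p x) *\<^sub>R x"
    by (simp add: gderiv_def)
  have "v = grad p x - (real n * p x) *\<^sub>R x" if "GDERIV (\<lambda>y. Y (sgn y)) x :> v" for v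
  proof -
    have "(\<lambda>h. h \<bullet> v) = (\<lambda>h. h \<bullet> (grad p x - (real n * p x) *\<^sub>R x))"
      using that g unfolding gderiv_def by (rule has_derivative_unique)
    then show ?thesis
      by (simp only: fun_eq_iff vector_eq_ldot)
  qed
  with g show ?thesis
    unfolding surface_grad_def by (rule the_equality)
qed

text \<open>The normal term of \<open>G_ext\<close> restores exactly the radial component that the
  surface gradient lacks.\<close>

lemma G_ext_eq_grad:
  assumes "real_polynomial_function p" "\<And>t x. p (t *\<^sub>R x) = t ^ n * p x"
    and "\<And>x. x \<in> unit_sphere \<Longrightarrow> Y n k x = p x" and "x \<in> unit_sphere"
  shows "G_ext Y n k x = grad p x"
  by (simp only: G_ext_def surface_grad_homogeneous[OF assms] assms(3)[OF assms(4)] diff_add_cancel)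

lemma G_ext_diff_G_int: "G_ext Y n k x - G_int Y n k x = (real (2 * n + 1) * Y n k x) *\<^sub>R x"
proof -
  have "real (2 * n + 1) * Y n k x = real n * Y n k x + real (n + 1) * Y n k x"
    by (simp add: algebra_simps)
  then show ?thesis
    by (simp add: G_ext_def G_int_def scaleR_add_left)
qed

lemma spherical_harmonic_basis_polynomial:
  assumes "spherical_harmonic_basis Y" "\<bar>k\<bar> \<le> int n"
  obtains p where "real_polynomial_function p" "\<And>t x. p (t *\<^sub>R x) = t ^ n * p x"
    "\<And>x. laplacian p x = 0" "\<And>x. x \<in> unit_sphere \<Longrightarrow> Y n k x = p x"
    "\<And>x. x \<in> unit_sphere \<Longrightarrow> G_ext Y n k x = grad p x"
proof -
  have "spherical_harmonic n (Y n k)"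
    using assms unfolding spherical_harmonic_basis_def by blast
  then obtain p where p: "real_polynomial_function p" "\<And>t x. p (t *\<^sub>R x) = t ^ n * p x"
    "\<And>x. laplacian p x = 0" "\<And>x. x \<in> unit_sphere \<Longrightarrow> Y n k x = p x"
    unfolding spherical_harmonic_def by blast
  show ?thesis
    by (rule that[OF p G_ext_eq_grad[where p = p and n = n and k = k and Y = Y, OF p(1,2,4)]])
qed

lemma continuous_on_grad:
  "real_polynomial_function p \<Longrightarrow> continuous_on S (grad p)"
  unfolding grad_def[abs_def]
  by (intro continuous_intros continuous_on_real_polynomial_function real_polynomial_function_dir_deriv)

lemma continuous_on_spherical_harmonics:
  assumes "spherical_harmonic_basis Y" "\<bar>k\<bar> \<le> int n"
  shows "continuous_on unit_sphere (Y n k)" "continuous_on unit_sphere (G_ext Y n k)"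
proof -
  obtain p where p: "real_polynomial_function p" "\<And>t x. p (t *\<^sub>R x) = t ^ n * p x" "\<And>x. laplacian p x = 0"
    "\<And>x. x \<in> unit_sphere \<Longrightarrow> Y n k x = p x" "\<And>x. x \<in> unit_sphere \<Longrightarrow> G_ext Y n k x = grad p x"
    using spherical_harmonic_basis_polynomial[OF assms] by blast
  show "continuous_on unit_sphere (Y n k)"
    by (rule iffD2[OF continuous_on_cong[OF refl p(4)] continuous_on_real_polynomial_function[OF p(1)]])
  show "continuous_on unit_sphere (G_ext Y n k)"
    by (rule iffD2[OF continuous_on_cong[OF refl p(5)] continuous_on_grad[OF p(1)]])
qed

text \<open>Green's identity reduces the orthogonality of the gradients to that of the scalar
  harmonics; for equal degrees its factor becomes \<open>n * (2 * n + 1)\<close>.\<close>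

lemma L2_inner_G_ext:
  assumes Y: "spherical_harmonic_basis Y" and k: "\<bar>k\<bar> \<le> int n" and l: "\<bar>l\<bar> \<le> int m"
  shows "L2_inner sphere_measure (G_ext Y n k) (G_ext Y m l)
           = (if n = m \<and> k = l then real n * (2 * real n + 1) else 0)"
proof -
  obtain p where p: "real_polynomial_function p" "\<And>t x. p (t *\<^sub>R x) = t ^ n * p x" "\<And>x. laplacian p x = 0"
    "\<And>x. x \<in> unit_sphere \<Longrightarrow> Y n k x = p x" "\<And>x. x \<in> unit_sphere \<Longrightarrow> G_ext Y n k x = grad p x"
    using spherical_harmonic_basis_polynomial[OF Y k] by blast
  obtain q where q: "real_polynomial_function q" "\<And>t x. q (t *\<^sub>R x) = t ^ m * q x" "\<And>x. laplacian q x = 0"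
    "\<And>x. x \<in> unit_sphere \<Longrightarrow> Y m l x = q x" "\<And>x. x \<in> unit_sphere \<Longrightarrow> G_ext Y m l x = grad q x"
    using spherical_harmonic_basis_polynomial[OF Y l] by blast
  have "L2_inner sphere_measure (G_ext Y n k) (G_ext Y m l) = (\<integral>x. grad p x \<bullet> grad q x \<partial>sphere_measure)"
    unfolding L2_inner_def using p(5) q(5)
    by (intro Bochner_Integration.integral_cong) (auto simp: space_sphere_measure)
  also have "\<dots> = real m * (real n + real m + 1) * (\<integral>x. p x * q x \<partial>sphere_measure)"
    by (rule integral_grad_inner_grad[OF p(1,2) q(1-3)])
  also have "(\<integral>x. p x * q x \<partial>sphere_measure) = L2_inner sphere_measure (Y n k) (Y m l)"
    unfolding L2_inner_def using p(4) q(4)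
    by (intro Bochner_Integration.integral_cong) (auto simp: space_sphere_measure)
  also have "\<dots> = (if n = m \<and> k = l then 1 else 0)"
    using Y k l unfolding spherical_harmonic_basis_def by blast
  finally show ?thesis by auto
qed

section \<open>The splitting of a normal field\<close>

text \<open>Pairing degree and order gives all families one common index set, as the lemmas on
  \<open>fun_span\<close> of an image require.\<close>

definition harmonic_index :: "(nat \<times> int) set" where
  "harmonic_index = {(n, k). \<bar>k\<bar> \<le> int n}"

definition scalar_harmonic :: "(nat \<Rightarrow> int \<Rightarrow> real^3 \<Rightarrow> real) \<Rightarrow> nat \<times> int \<Rightarrow> real^3 \<Rightarrow> real" where
  "scalar_harmonic Y = (\<lambda>(n, k). Y n k)"

text \<open>The components of \<open>\<eta> Y\<^bsub>n,k\<^esub>\<close> in the two Hardy spaces.\<close>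

definition ext_part :: "(nat \<Rightarrow> int \<Rightarrow> real^3 \<Rightarrow> real) \<Rightarrow> nat \<times> int \<Rightarrow> real^3 \<Rightarrow> real^3" where
  "ext_part Y = (\<lambda>(n, k) x. (1 / real (2 * n + 1)) *\<^sub>R G_ext Y n k x)"

definition int_part :: "(nat \<Rightarrow> int \<Rightarrow> real^3 \<Rightarrow> real) \<Rightarrow> nat \<times> int \<Rightarrow> real^3 \<Rightarrow> real^3" where
  "int_part Y = (\<lambda>(n, k) x. (- 1 / real (2 * n + 1)) *\<^sub>R G_int Y n k x)"

lemma scalar_harmonic_normal: "scalar_harmonic Y j x *\<^sub>R x = ext_part Y j x + int_part Y j x"
proof -
  obtain n k where j: "j = (n, k)" by (cases j)
  have "ext_part Y j x + int_part Y j x = (1 / real (2 * n + 1)) *\<^sub>R (G_ext Y n k x - G_int Y n k x)"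
    by (simp add: j ext_part_def int_part_def scaleR_diff_right)
  also have "\<dots> = scalar_harmonic Y j x *\<^sub>R x"
    by (simp only: G_ext_diff_G_int) (simp add: j scalar_harmonic_def)
  finally show ?thesis by simp
qed

lemma continuous_on_parts:
  assumes "spherical_harmonic_basis Y" "j \<in> harmonic_index"
  shows "continuous_on unit_sphere (scalar_harmonic Y j)" "continuous_on unit_sphere (ext_part Y j)"
  using assms continuous_on_spherical_harmonics[of Y]
  by (auto simp: harmonic_index_def scalar_harmonic_def ext_part_def intro!: continuous_intros)

text \<open>
  The squared norm of \<open>ext_part Y (n, k)\<close> is \<open>n / (2 * n + 1) \<le> 1\<close>.
\<close>

lemma integral_ext_part_le:
  assumes Y: "spherical_harmonic_basis Y" and J: "J \<subseteq> harmonic_index"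
  shows "(\<integral>x. (norm (\<Sum>j\<in>J. c j *\<^sub>R ext_part Y j x))\<^sup>2 \<partial>sphere_measure)
           \<le> (\<integral>x. (norm (\<Sum>j\<in>J. c j *\<^sub>R scalar_harmonic Y j x))\<^sup>2 \<partial>sphere_measure)"
proof -
  let ?e = "\<lambda>(n, k :: int). real n / (2 * real n + 1)"
  have "(\<integral>x. (norm (\<Sum>j\<in>J. c j *\<^sub>R ext_part Y j x))\<^sup>2 \<partial>sphere_measure) = (\<Sum>j\<in>J. (c j)\<^sup>2 * ?e j)"
  proof (rule integral_norm_square_sum_orthogonal)
    fix i j assume ij: "i \<in> J" "j \<in> J"
    have c: "continuous_on unit_sphere (ext_part Y i)" "continuous_on unit_sphere (ext_part Y j)"
      by (intro continuous_on_parts[OF Y] subsetD[OF J] ij)+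
    show "integrable sphere_measure (\<lambda>x. ext_part Y i x \<bullet> ext_part Y j x)"
      by (intro continuous_integrable_sphere_measure continuous_intros c)
    obtain n k m l where nk: "i = (n, k)" "j = (m, l)" by (cases i, cases j)
    then have kl: "\<bar>k\<bar> \<le> int n" "\<bar>l\<bar> \<le> int m"
      using ij J by (auto simp: harmonic_index_def)
    have "L2_inner sphere_measure (ext_part Y i) (ext_part Y j)
        = (1 / real (2 * n + 1)) * ((1 / real (2 * m + 1)) * L2_inner sphere_measure (G_ext Y n k) (G_ext Y m l))"
      by (simp add: L2_inner_def ext_part_def nk)
    also have "\<dots> = (if i = j then ?e i else 0)"
    proof -
      have "2 * real n + 1 \<noteq> 0" by linarith
      then have "(1 / (2 * real n + 1)) * ((1 / (2 * real n + 1)) * (real n * (2 * real n + 1))) = ?e i"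
        by (simp add: nk)
      moreover have "real (2 * n + 1) = 2 * real n + 1" by simp
      ultimately show ?thesis
        unfolding L2_inner_G_ext[OF Y kl] by (simp only: nk) auto
    qed
    finally show "L2_inner sphere_measure (ext_part Y i) (ext_part Y j) = (if i = j then ?e i else 0)" .
  qed
  also have "\<dots> \<le> (\<Sum>j\<in>J. (c j)\<^sup>2 * 1)"
    by (intro sum_mono mult_left_mono) (auto simp: field_simps)
  also have "\<dots> = (\<integral>x. (norm (\<Sum>j\<in>J. c j *\<^sub>R scalar_harmonic Y j x))\<^sup>2 \<partial>sphere_measure)"
  proof (rule integral_norm_square_sum_orthogonal[symmetric])
    fix i j assume ij: "i \<in> J" "j \<in> J"
    have c: "continuous_on unit_sphere (scalar_harmonic Y i)" "continuous_on unit_sphere (scalar_harmonic Y j)"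
      by (intro continuous_on_parts[OF Y] subsetD[OF J] ij)+
    show "integrable sphere_measure (\<lambda>x. scalar_harmonic Y i x \<bullet> scalar_harmonic Y j x)"
      by (intro continuous_integrable_sphere_measure continuous_intros c)
    obtain n k m l where nk: "i = (n, k)" "j = (m, l)" by (cases i, cases j)
    then have "\<bar>k\<bar> \<le> int n" "\<bar>l\<bar> \<le> int m"
      using ij J by (auto simp: harmonic_index_def)
    then have "L2_inner sphere_measure (Y n k) (Y m l) = (if n = m \<and> k = l then 1 else 0)"
      using Y unfolding spherical_harmonic_basis_def by blast
    then show "L2_inner sphere_measure (scalar_harmonic Y i) (scalar_harmonic Y j) = (if i = j then 1 else 0)"
      by (simp add: scalar_harmonic_def nk)
  qed
  finally show ?thesis .
qed

text \<open>\<open>hardy_plus\<close> starts at degree 1, while expansions of a normal field also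
  involve degree 0. The exterior part of that term is the gradient of a constant.\<close>

lemma G_ext_0:
  assumes Y: "spherical_harmonic_basis Y" and x: "x \<in> unit_sphere"
  shows "G_ext Y 0 0 x = 0"
proof -
  obtain p where p: "\<And>t x. p (t *\<^sub>R x) = t ^ 0 * p x"
    "\<And>x. x \<in> unit_sphere \<Longrightarrow> G_ext Y 0 0 x = grad p x"
    using spherical_harmonic_basis_polynomial[OF Y, of 0 0] by (metis abs_zero of_nat_0 order_refl)
  obtain c where "p = (\<lambda>x. c)"
  proof
    show "p = (\<lambda>x. p 0)"
    proof
      \<comment> \<open>Homogeneity is used at \<open>t = 0\<close>, where
        \<open>0 ^ 0 = 1\<close>.\<close>
      show "p x = p 0" for x using p(1)[of 0 x] by simp
    qed
  qed
  then show ?thesis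
    by (simp add: p(2)[OF x] grad_def dir_deriv_eq[OF has_derivative_const])
qed

text \<open>Finite harmonic sums \<open>?Q i\<close> approximate \<open>h\<close>. Their exterior
  parts \<open>?U i\<close> form a Cauchy sequence by the contraction estimate, and \<open>f\<close>
  is its limit. The remainder of the normal field is then the limit of the interior parts
  \<open>?V i\<close>.\<close>

lemma normal_field_splitting:
  assumes Y: "spherical_harmonic_basis Y" and h: "h \<in> L2 sphere_measure"
  obtains f where "f \<in> hardy_plus Y" "(\<lambda>x. h x *\<^sub>R x - f x) \<in> hardy_minus Y"
proof -
  let ?S = "sphere_measure"
  let ?q = "\<lambda>J c x. \<Sum>j\<in>J. c j *\<^sub>R scalar_harmonic Y j x"
  let ?u = "\<lambda>J c x. \<Sum>j\<in>J. c j *\<^sub>R ext_part Y j x"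
  let ?v = "\<lambda>J c x. \<Sum>j\<in>J. c j *\<^sub>R int_part Y j x"
  have diff_diff_swap: "(a - f) - (b - u) = (a - b) - (f - u)" for a b f u :: "real^3"
    by (simp add: add_diff_eq diff_diff_eq2 diff_diff_add add.commute)
  have quv: "?q J c x *\<^sub>R x - ?u J c x = ?v J c x" for J c x
  proof -
    have "?q J c x *\<^sub>R x = (\<Sum>j\<in>J. c j *\<^sub>R (ext_part Y j x + int_part Y j x))"
      by (simp add: scaleR_sum_left flip: scalar_harmonic_normal)
    also have "\<dots> = ?u J c x + ?v J c x"
      by (simp only: scaleR_add_right sum.distrib)
    finally show ?thesis by simp
  qed
  have q2: "?q J c \<in> L2 ?S" and u2: "?u J c \<in> L2 ?S" if "J \<subseteq> harmonic_index" for J c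
    by (intro continuous_L2_sphere_measure continuous_intros continuous_on_parts[OF Y] subsetD[OF that];
        assumption)+
  have "h \<in> L2_closure ?S (fun_span {Y n k | n k. \<bar>k\<bar> \<le> int n})"
    using Y h unfolding spherical_harmonic_basis_def by blast
  moreover have "{Y n k | n k. \<bar>k\<bar> \<le> int n} = scalar_harmonic Y ` harmonic_index"
    by (auto simp: scalar_harmonic_def harmonic_index_def image_iff)
  ultimately have h': "\<exists>g\<in>fun_span (scalar_harmonic Y ` harmonic_index) \<inter> L2 ?S. L2_norm ?S (\<lambda>x. h x - g x) < e"
    if "e > 0" for e
    using that by (auto simp: L2_closure_def)
  \<comment> \<open>A squared error below \<open>(1/4) ^ i\<close> is an error below
    \<open>(1/2) ^ i\<close> in norm, which provides the geometric rate for the completeness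
    lemma.\<close>
  define good where "good i J c \<longleftrightarrow> finite J \<and> J \<subseteq> harmonic_index \<and>
      (\<integral>x. (norm (h x - ?q J c x))\<^sup>2 \<partial>?S) < (1/4) ^ i" for i :: nat and J c
  have "\<exists>J c. good i J c" for i
  proof -
    obtain g where g: "g \<in> fun_span (scalar_harmonic Y ` harmonic_index)"
      and "L2_norm ?S (\<lambda>x. h x - g x) < (1/2) ^ i"
      using h'[of "(1/2) ^ i"] by auto
    then have "(\<integral>x. (norm (h x - g x))\<^sup>2 \<partial>?S) < ((1/2) ^ i)\<^sup>2"
      by (subst (asm) L2_norm_less_iff) auto
    also have "((1/2::real) ^ i)\<^sup>2 = ((1/2)\<^sup>2) ^ i"
      by (simp only: power_mult[symmetric] mult.commute)
    also have "(1/2::real)\<^sup>2 = 1/4"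
      by (simp add: power2_eq_square)
    finally have *: "(\<integral>x. (norm (h x - g x))\<^sup>2 \<partial>?S) < (1/4) ^ i" .
    obtain J c where "finite J" "J \<subseteq> harmonic_index" "g = ?q J c"
      using fun_span_imageE[OF g] .
    with * have "good i J c" by (simp only: good_def simp_thms)
    then show ?thesis by blast
  qed
  then obtain J c where "\<And>i. good i (J i) (c i)"
    by metis
  then have J: "finite (J i)" "J i \<subseteq> harmonic_index"
    and approx: "(\<integral>x. (norm (h x - ?q (J i) (c i) x))\<^sup>2 \<partial>?S) < (1/4) ^ i" for i
    unfolding good_def by blast+
  let ?Q = "\<lambda>i. ?q (J i) (c i)" and ?U = "\<lambda>i. ?u (J i) (c i)" and ?V = "\<lambda>i. ?v (J i) (c i)"
  \<comment> \<open>The difference of two exterior parts has the same coefficients as the difference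
    of the scalar sums, so the contraction estimate applies. Comparing both sums with
    \<open>h\<close> gives 2 + 2 = 4 as the constant.\<close>
  have Cauchy: "(\<integral>x. (norm (?U i x - ?U m x))\<^sup>2 \<partial>?S) \<le> 4 * (1/4) ^ i" if "i \<le> m" for i m
  proof -
    let ?K = "J i \<union> J m"
    let ?d = "\<lambda>j. (if j \<in> J i then c i j else 0) - (if j \<in> J m then c m j else 0)"
    have "(\<integral>x. (norm (?U i x - ?U m x))\<^sup>2 \<partial>?S) = (\<integral>x. (norm (?u ?K ?d x))\<^sup>2 \<partial>?S)"
      by (simp only: sum_scaleR_diff_Un[OF J(1) J(1)])
    also have "\<dots> \<le> (\<integral>x. (norm (?q ?K ?d x))\<^sup>2 \<partial>?S)"
      using J by (intro integral_ext_part_le[OF Y]) auto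
    also have "\<dots> = (\<integral>x. (norm ((h x - ?Q m x) - (h x - ?Q i x)))\<^sup>2 \<partial>?S)"
      by (simp only: sum_scaleR_diff_Un[OF J(1) J(1), symmetric] diff_diff_eq2 diff_add_cancel diff_diff_eq)
         (simp add: algebra_simps)
    also have "\<dots> \<le> 2 * (\<integral>x. (norm (h x - ?Q m x))\<^sup>2 \<partial>?S) + 2 * (\<integral>x. (norm (h x - ?Q i x))\<^sup>2 \<partial>?S)"
      by (intro integral_norm_diff_square_le L2_diff h q2 J)
    also have "\<dots> \<le> 2 * (1/4) ^ m + 2 * (1/4) ^ i"
      using approx[of m] approx[of i] by simp
    also have "\<dots> \<le> 4 * (1/4) ^ i"
      using power_decreasing[OF that, of "1/4::real"] by simp
    finally show ?thesis .
  qed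
  obtain f where f: "f \<in> L2 ?S" and conv: "\<And>i. (\<integral>x. (norm (?U i x - f x))\<^sup>2 \<partial>?S) \<le> 4 * (1/4) ^ i"
    using L2_complete_rapidly_Cauchy[OF finite_measure_sphere_measure u2[OF J(2)] Cauchy] by blast
  \<comment> \<open>The constant 10 is 2 * 1 + 2 * 4, from the errors of \<open>?Q i\<close> and
    \<open>?U i\<close> that enter the interior part; it also covers the bound 4 for the exterior
    part.\<close>
  have small: "\<exists>i. 10 * (1/4) ^ i < e\<^sup>2" if "e > 0" for e :: real
  proof -
    have "\<exists>i. (1/4::real) ^ i < e\<^sup>2 / 10"
      using that by (intro real_arch_pow_inv) auto
    then obtain i where "(1/4::real) ^ i < e\<^sup>2 / 10" ..
    then have "10 * (1/4) ^ i < e\<^sup>2" by linarith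
    then show ?thesis by blast
  qed
  show ?thesis
  proof
    show "f \<in> hardy_plus Y"
      unfolding hardy_plus_def L2_closure_def
    proof (intro CollectI conjI allI impI f)
      fix e :: real assume e: "e > 0"
      then obtain i where i: "10 * (1/4) ^ i < e\<^sup>2" using small by blast
      \<comment> \<open>The degree 0 term is outside the span defining \<open>hardy_plus\<close>;
        removing it leaves the sum unchanged on the sphere.\<close>
      let ?J = "J i - {(0, 0)}"
      let ?g = "\<lambda>x. \<Sum>j\<in>?J. (c i j / real (2 * fst j + 1)) *\<^sub>R (case j of (n, k) \<Rightarrow> G_ext Y n k) x"
      have g: "?g = ?u ?J (c i)"
        by (simp add: ext_part_def case_prod_unfold)
      have "?g \<in> fun_span {G_ext Y n k | n k. n \<ge> 1 \<and> \<bar>k\<bar> \<le> int n}"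
        using J[of i] by (intro fun_span_imageI) (fastforce simp: harmonic_index_def)+
      moreover have "?g \<in> L2 ?S"
        unfolding g using J by (intro u2) auto
      moreover have "L2_norm ?S (\<lambda>x. f x - ?g x) < e"
      proof -
        have "?U i x = ?g x" if "x \<in> space ?S" for x
          unfolding fun_cong[OF g] using that G_ext_0[OF Y, of x]
          by (intro sum.mono_neutral_right J) (auto simp: ext_part_def space_sphere_measure)
        then have "(\<integral>x. (norm (f x - ?g x))\<^sup>2 \<partial>?S) = (\<integral>x. (norm (?U i x - f x))\<^sup>2 \<partial>?S)"
          by (intro Bochner_Integration.integral_cong) (simp_all add: norm_minus_commute)
        also have "\<dots> \<le> 10 * (1/4) ^ i" by (rule order_trans[OF conv]) simp
        also note i
        finally show ?thesis using e by (simp add: L2_norm_less_iff)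
      qed
      ultimately show "\<exists>g\<in>fun_span {G_ext Y n k | n k. n \<ge> 1 \<and> \<bar>k\<bar> \<le> int n} \<inter> L2 ?S.
          L2_norm ?S (\<lambda>x. f x - g x) < e"
        by - (intro bexI[of _ ?g] IntI)
    qed
    have normal2: "(\<lambda>x. w x *\<^sub>R x) \<in> L2 ?S" if "w \<in> L2 ?S" for w :: "real^3 \<Rightarrow> real"
    proof -
      have [measurable]: "(\<lambda>x. x) \<in> borel_measurable ?S" "w \<in> borel_measurable ?S"
        using that by (auto simp: L2_def intro: continuous_measurable_sphere_measure)
      have "integrable ?S (\<lambda>x. (norm (w x *\<^sub>R x))\<^sup>2) \<longleftrightarrow> integrable ?S (\<lambda>x. (norm (w x))\<^sup>2)"
        by (intro Bochner_Integration.integrable_cong) (auto simp: space_sphere_measure)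
      with that show ?thesis by (simp add: L2_def)
    qed
    show "(\<lambda>x. h x *\<^sub>R x - f x) \<in> hardy_minus Y"
      unfolding hardy_minus_def L2_closure_def
    proof (intro CollectI conjI allI impI)
      show "(\<lambda>x. h x *\<^sub>R x - f x) \<in> L2 ?S"
        by (intro L2_diff normal2 h f)
      fix e :: real assume e: "e > 0"
      then obtain i where i: "10 * (1/4) ^ i < e\<^sup>2" using small by blast
      have "?V i = (\<lambda>x. \<Sum>j\<in>J i. (- c i j / real (2 * fst j + 1)) *\<^sub>R (case j of (n, k) \<Rightarrow> G_int Y n k) x)"
        by (simp add: int_part_def case_prod_unfold)
      also have "\<dots> \<in> fun_span {G_int Y n k | n k. \<bar>k\<bar> \<le> int n}"
        using J[of i] by (intro fun_span_imageI) (fastforce simp: harmonic_index_def)+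
      finally have "?V i \<in> fun_span {G_int Y n k | n k. \<bar>k\<bar> \<le> int n}" .
      moreover have "?V i \<in> L2 ?S"
        unfolding quv[symmetric] by (intro L2_diff normal2 q2 u2 J)
      moreover have "L2_norm ?S (\<lambda>x. (h x *\<^sub>R x - f x) - ?V i x) < e"
      proof -
        \<comment> \<open>The error of the interior part splits into the normal error of the scalar
          approximation, whose length on the sphere is that of \<open>h x - ?Q i x\<close>, and the
          error of the exterior part.\<close>
        have "(h x *\<^sub>R x - f x) - ?V i x = (h x - ?Q i x) *\<^sub>R x - (f x - ?U i x)" for x
          unfolding quv[symmetric] scaleR_diff_left by (rule diff_diff_swap)
        then have "(\<integral>x. (norm ((h x *\<^sub>R x - f x) - ?V i x))\<^sup>2 \<partial>?S)
            = (\<integral>x. (norm ((h x - ?Q i x) *\<^sub>R x - (f x - ?U i x)))\<^sup>2 \<partial>?S)"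
          by (simp only:)
        also have "\<dots> \<le> 2 * (\<integral>x. (norm ((h x - ?Q i x) *\<^sub>R x))\<^sup>2 \<partial>?S) + 2 * (\<integral>x. (norm (f x - ?U i x))\<^sup>2 \<partial>?S)"
          by (intro integral_norm_diff_square_le normal2 L2_diff h f q2 u2 J)
        also have "(\<integral>x. (norm ((h x - ?Q i x) *\<^sub>R x))\<^sup>2 \<partial>?S) = (\<integral>x. (norm (h x - ?Q i x))\<^sup>2 \<partial>?S)"
          by (intro Bochner_Integration.integral_cong) (auto simp: space_sphere_measure)
        also have "(\<integral>x. (norm (f x - ?U i x))\<^sup>2 \<partial>?S) = (\<integral>x. (norm (?U i x - f x))\<^sup>2 \<partial>?S)"
          by (simp add: norm_minus_commute)
        also have "2 * (\<integral>x. (norm (h x - ?Q i x))\<^sup>2 \<partial>?S) + 2 * \<dots> \<le> 10 * (1/4) ^ i"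
          using approx[of i] conv[of i] by linarith
        also note i
        finally show ?thesis using e by (simp add: L2_norm_less_iff)
      qed
      ultimately show "\<exists>g\<in>fun_span {G_int Y n k | n k. \<bar>k\<bar> \<le> int n} \<inter> L2 ?S.
          L2_norm ?S (\<lambda>x. (h x *\<^sub>R x - f x) - g x) < e"
        by - (intro bexI[of _ "?V i"] IntI)
    qed
  qed
qed

section \<open>The null space\<close>

text \<open>The punctured cone over a relatively open set is open in space, and a non-empty open set
  has positive volume.\<close>

lemma sphere_measure_open_not_null:
  assumes "open W" "unit_sphere \<inter> W \<noteq> {}"
  shows "unit_sphere \<inter> W \<notin> null_sets sphere_measure"
proof
  let ?C = "{x \<in> ball 0 1 - {0}. sgn x \<in> unit_sphere \<inter> W}"
  assume "unit_sphere \<inter> W \<in> null_sets sphere_measure"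
  then have "emeasure lborel ?C = 0"
    using emeasure_sphere_measure[of "unit_sphere \<inter> W"] by (auto simp: null_sets_def)
  moreover have C: "?C = (ball 0 1 - {0}) \<inter> sgn -` W"
    by (auto simp: norm_sgn)
  moreover have "continuous_on (ball 0 1 - {0}) (sgn :: real^3 \<Rightarrow> real^3)"
    unfolding sgn_div_norm[abs_def] by (intro continuous_intros) auto
  then have o: "open ?C"
    unfolding C using assms(1) by (intro continuous_open_preimage) auto
  ultimately have "?C \<in> null_sets lborel"
    by (intro null_setsI) auto
  then have "negligible ?C"
    by (simp add: negligible_iff_null_sets null_sets_completionI)
  with o have "?C = {}"
    using open_not_negligible by blast
  moreover obtain w where w: "w \<in> unit_sphere \<inter> W"
    using assms(2) by blast
  have "sgn w = w" using w by (simp add: sgn_div_norm)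
  \<comment> \<open>A point \<open>w\<close> of the sphere lies outside the open ball, so it is
    halved to obtain a point of the cone in the same direction.\<close>
  then have "(1/2) *\<^sub>R w \<in> ?C"
    using w by (auto simp: sgn_scaleR)
  ultimately show False by blast
qed

theorem theorem2:
  fixes Y :: "nat \<Rightarrow> int \<Rightarrow> real^3 \<Rightarrow> real" and U :: "(real^3) set"
  assumes "spherical_harmonic_basis Y"
    and "patch U"
  shows "\<exists>(f, g) \<in> restriction_kernel Y U.
           \<not> ((AE x in sphere_measure. f x = 0) \<and> (AE x in sphere_measure. g x = 0))"
proof -
  interpret finite_measure sphere_measure by (rule finite_measure_sphere_measure)
  define V where "V = unit_sphere \<inter> - closure U"
  have V: "V \<in> sets sphere_measure"
    by (auto simp: V_def sets_sphere_measure sets_restrict_space)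
  have V0: "V \<notin> null_sets sphere_measure"
    unfolding V_def using assms(2) by (intro sphere_measure_open_not_null) (auto simp: patch_def)
  define h :: "real^3 \<Rightarrow> real" where "h = indicator V"
  have "h \<in> L2 sphere_measure"
    unfolding L2_def h_def using V
    by (auto intro!: integrable_const_bound[of _ 1] simp: indicator_def)
  then obtain f where f: "f \<in> hardy_plus Y" and g: "(\<lambda>x. h x *\<^sub>R x - f x) \<in> hardy_minus Y"
    using normal_field_splitting[OF assms(1)] by blast
  \<comment> \<open>On \<open>U\<close> the normal field vanishes, so the two components cancel
    there at every point.\<close>
  have "h x = 0" if "x \<in> U" for x
    using that closure_subset[of U] by (auto simp: h_def V_def)
  then have "AE x in restrict_space sphere_measure U. restriction_op U (f, \<lambda>x. h x *\<^sub>R x - f x) x = 0"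
    by (intro AE_I2) (auto simp: restriction_op_def space_restrict_space)
  with f g have ker: "(f, \<lambda>x. h x *\<^sub>R x - f x) \<in> restriction_kernel Y U"
    by (simp add: restriction_kernel_def)
  have "\<not> ((AE x in sphere_measure. f x = 0) \<and> (AE x in sphere_measure. h x *\<^sub>R x - f x = 0))"
  proof
    assume "(AE x in sphere_measure. f x = 0) \<and> (AE x in sphere_measure. h x *\<^sub>R x - f x = 0)"
    then have f0: "AE x in sphere_measure. f x = 0" and g0: "AE x in sphere_measure. h x *\<^sub>R x - f x = 0"
      by auto
    \<comment> \<open>If both components vanished, so would \<open>h x *\<^sub>R x\<close>. Points
      of the sphere are non-zero vectors, hence \<open>h\<close> would vanish almost everywhere,
      although \<open>V\<close> has positive measure.\<close>
    from f0 g0 AE_space have "AE x in sphere_measure. x \<notin> V"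
    proof eventually_elim
      case (elim x)
      then have "h x = 0" by (auto simp: space_sphere_measure)
      then show ?case by (auto simp: h_def indicator_eq_0_iff)
    qed
    with V V0 show False by (simp add: AE_iff_null_sets)
  qed
  with ker show ?thesis by (intro bexI[of _ "(f, \<lambda>x. h x *\<^sub>R x - f x)"]) simp_all
qed

end
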